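(* Let $n\ge2$ and let $\mathcal{M}=\partial D\subset\mathbb{R}^n$ be the boundary of a bounded domain $D$, strictly starlike with respect to the origin, which satisfies the $\alpha$-tangent condition for some $\alpha\in(0,\pi/2]$. Let $f_{\mathcal{M}}:\overline{\mathbb{R}}^n\to\overline{\mathbb{R}}^n$ be the quasi-inversion in $\mathcal{M}$. Then $f_{\mathcal{M}}$ is a $K$-quasiconformal mapping with $$K=\cot^2\frac{\alpha}{2}.$$ If $n=2$, then $k=(K-1)/(K+1)=\cos\alpha$. Furthermore, if $\mathcal{M}_t$, $t\in[0,1]$, is a family of surfaces smoothly converging to the sphere $S^{n-1}(r)$, $r>0$, as $t\to0$, then the quasiconformality constants $K_t$ of the quasi-inversions $f_{\mathcal{M}_t}$ tend to $1$ as $t\to0$.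
   Context: $\overline{\mathbb{R}}^n=\mathbb{R}^n\cup\{\infty\}$, $S^{n-1}$ is the unit sphere, $S^{n-1}(r)$ the sphere of radius $r$ centered at $0$. A bounded domain $D\subset\mathbb{R}^n$ is strictly starlike with respect to the point $a$ if each ray emanating from $a$ meets $\partial D$ at exactly one point (in particular $a\in D$). Quasi-inversion: for $x\in\mathbb{R}^n\setminus\{0\}$ let $r_x=|w|$, where $w$ is the unique point of $\{tx:t>0\}\cap\mathcal{M}$. Then $f_{\mathcal{M}}(x)=\frac{r_x^2}{|x|^2}x$ for $x\in\mathbb{R}^n\setminus\{0\}$, $f_{\mathcal{M}}(0)=\infty$, $f_{\mathcal{M}}(\infty)=0$. Tangent condition: for $x,z\in\partial D$, $z\ne x$, let $\alpha(z,x)\in[0,\pi/2]$ be the acute angle which the segment $[z,x]$ makes with the ray from $0$ through $x$, i.e. $\cos\alpha(z,x)=\frac{|\langle z-x,x\rangle|}{|z-x||x|}$, and put $\alpha(x)=\liminf_{z\to x,\,z\in\partial D}\alpha(z,x)$. $D$ (and $\partial D$) satisfies the $\alpha$-tangent condition if $\alpha(x)\ge\alpha$ for every $x\in\partial D$. Quasiconformality: for $f$ differentiable at $x$, $\Lambda_f(x)=\max_{|h|=1}|f'(x)h|$, $\lambda_f(x)=\min_{|h|=1}|f'(x)h|$, $H(f'(x))=\Lambda_f(x)/\lambda_f(x)$. A homeomorphism $f$ between domains of $\mathbb{R}^n$ is quasiconformal if it is ACL (absolutely continuous on lines), differentiable a.e., and for some $C<\infty$, $\Lambda_f(x)^n/C\le|J(x,f)|\le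 C\lambda_f(x)^n$ for a.e. $x$; it is $K$-quasiconformal if moreover $H(f'(x))\le K$ for a.e. $x$. A homeomorphism of $\overline{\mathbb{R}}^n$ is $K$-quasiconformal if its restriction to $\mathbb{R}^n\setminus\{f^{-1}(\infty)\}$ with the point $\infty$ removed (here: to $\mathbb{R}^n\setminus\{0\}$) is. The quasiconformality constant is the smallest such $K$. For $n=2$, $f$ is also called $k$-quasiconformal with $k=(K-1)/(K+1)$, i.e. $|f_{\bar z}/f_z|\le k$ a.e. in the sense-preserving case. Smooth convergence: for $t\in[0,1]$ let $\mathcal{M}_t$ be the boundary of a bounded domain strictly starlike with respect to $0$ which satisfies the $\alpha_{\mathcal{M}_t}$-tangent condition, and let $\varphi_t:\mathbb{R}^n\to\mathbb{R}^n$ be the radial extension which sends the unit sphere to $\mathcal{M}_t$, i.e. $\varphi_t(0)=0$ and, for $x\ne0$, $\varphi_t(x)=|x|\,\varphi^{(t)}(x/|x|)$, where $\varphi^{(t)}(u)$ is the unique point of $\mathcal{M}_t$ on the ray from $0$ through $u\in S^{n-1}$. $\mathcal{M}_t$ smoothly converges to $S^{n-1}(r)$ as $t\to0$ if $\lim_{t\to0}\operatorname{ess\,sup}_{|x|=1}|\varphi_t'(x)-r\mathbf{I}|=0$, where $\mathbf{I}$ is the identity matrix and $|\cdot|$ the operator norm (this in particular means $\alpha_{\mathcal{M}_t}\to\pi/2$). *)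

theory Defs
  imports "HOL-Analysis.Analysis" "HOL-Probability.Essential_Supremum"
begin

section \<open>Strictly starlike domains and the tangent condition\<close>

definition strictly_starlike :: "'a::euclidean_space \<Rightarrow> 'a set \<Rightarrow> bool" where
  "strictly_starlike a D \<longleftrightarrow>
     open D \<and> connected D \<and> bounded D \<and> a \<in> D \<and>
     (\<forall>u. norm u = 1 \<longrightarrow> (\<exists>!w. w \<in> {a + t *\<^sub>R u | t. 0 \<le> t} \<inter> frontier D))"

definition tangent_angle :: "'a::euclidean_space \<Rightarrow> 'a \<Rightarrow> real" where
  "tangent_angle z x = arccos (\<bar>(z - x) \<bullet> x\<bar> / (norm (z - x) * norm x))"

definition tangent_condition :: "real \<Rightarrow> 'a::euclidean_space set \<Rightarrow> bool" where
  "tangent_condition \<alpha> M \<longleftrightarrow>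
     (\<forall>x\<in>M. ereal \<alpha> \<le> Liminf (at x within M) (\<lambda>z. ereal (tangent_angle z x)))"

section \<open>Quasi-inversion\<close>

definition radial_point :: "'a::euclidean_space set \<Rightarrow> 'a \<Rightarrow> 'a" where
  "radial_point M x = (THE w. w \<in> {t *\<^sub>R x | t. 0 < t} \<inter> M)"

text \<open>The extended space is the one-point compactification of the Euclidean space;
  following \<^const>\<open>Alexandroff_compactification\<close>, \<^term>\<open>None\<close> is the point at infinity.\<close>

definition quasi_inversion :: "'a::euclidean_space set \<Rightarrow> 'a option \<Rightarrow> 'a option" where
  "quasi_inversion M p =
     (case p of
        None \<Rightarrow> Some 0
      | Some x \<Rightarrow>
          if x = 0 then None
          else Some (((norm (radial_point M x))\<^sup>2 / (norm x)\<^sup>2) *\<^sub>R x))"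

section \<open>Quasiconformal mappings\<close>

definition max_stretch :: "('a::euclidean_space \<Rightarrow> 'a) \<Rightarrow> 'a \<Rightarrow> real" where
  "max_stretch f x = (SUP h\<in>sphere 0 1. norm (frechet_derivative f (at x) h))"

definition min_stretch :: "('a::euclidean_space \<Rightarrow> 'a) \<Rightarrow> 'a \<Rightarrow> real" where
  "min_stretch f x = (INF h\<in>sphere 0 1. norm (frechet_derivative f (at x) h))"

text \<open>Absolute continuity of a curve on an interval: \<open>P\<close> ranges over the finite families of
  non-overlapping subintervals, each given by its pair of end points.\<close>

definition abs_continuous_on_interval ::
  "(real \<Rightarrow> 'b::real_normed_vector) \<Rightarrow> real \<Rightarrow> real \<Rightarrow> bool" where
  "abs_continuous_on_interval g a b \<longleftrightarrow>
     (\<forall>\<epsilon>>0. \<exists>\<delta>>0. \<forall>P :: (real \<times> real) set.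
        finite P \<and> (\<forall>(s, t)\<in>P. a \<le> s \<and> s < t \<and> t \<le> b) \<and>
        pairwise (\<lambda>(s, t) (s', t'). {s<..<t} \<inter> {s'<..<t'} = {}) P \<and>
        (\<Sum>(s, t)\<in>P. t - s) < \<delta>
        \<longrightarrow> (\<Sum>(s, t)\<in>P. norm (g t - g s)) < \<epsilon>)"

text \<open>The segments of the box \<open>cbox a b\<close> in the \<open>i\<close>-th coordinate direction are indexed by the
  remaining coordinates \<open>y\<close>; almost every refers to the \<open>n - 1\<close> dimensional Lebesgue
  measure on these.\<close>

definition ACL_on :: "(real^'n) set \<Rightarrow> (real^'n \<Rightarrow> real^'n) \<Rightarrow> bool" where
  "ACL_on U f \<longleftrightarrow> continuous_on U f \<and>
     (\<forall>a b. cbox a b \<subseteq> U \<longrightarrow>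
       (\<forall>i. AE y in Pi\<^sub>M (UNIV - {i}) (\<lambda>_. lborel).
          (\<forall>j\<in>UNIV - {i}. a $ j \<le> y j \<and> y j \<le> b $ j) \<longrightarrow>
          abs_continuous_on_interval (\<lambda>s. f (\<chi> j. if j = i then s else y j)) (a $ i) (b $ i)))"

definition quasiconformal :: "(real^'n) set \<Rightarrow> (real^'n) set \<Rightarrow> (real^'n \<Rightarrow> real^'n) \<Rightarrow> bool" where
  "quasiconformal U V f \<longleftrightarrow>
     open U \<and> connected U \<and> U \<noteq> {} \<and> open V \<and> connected V \<and> V \<noteq> {} \<and>
     (\<exists>g. homeomorphism U V f g) \<and>
     ACL_on U f \<and>
     (AE x in lebesgue. x \<in> U \<longrightarrow> f differentiable at x) \<and>
     (\<exists>C>0. AE x in lebesgue. x \<in> U \<longrightarrow>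
        max_stretch f x ^ CARD('n) / C \<le> \<bar>det (jacobian f (at x))\<bar> \<and>
        \<bar>det (jacobian f (at x))\<bar> \<le> C * min_stretch f x ^ CARD('n))"

text \<open>The quotient \<open>H(f'(x)) = max_stretch f x / min_stretch f x\<close> makes sense only when
  \<^term>\<open>min_stretch f x > 0\<close>, which is therefore demanded along with the bound (division by zero
  would otherwise give the value 0).\<close>

definition K_quasiconformal ::
  "real \<Rightarrow> (real^'n) set \<Rightarrow> (real^'n) set \<Rightarrow> (real^'n \<Rightarrow> real^'n) \<Rightarrow> bool" where
  "K_quasiconformal K U V f \<longleftrightarrow> quasiconformal U V f \<and>
     (AE x in lebesgue. x \<in> U \<longrightarrow>
        0 < min_stretch f x \<and> max_stretch f x / min_stretch f x \<le> K)"

definition K_quasiconformal_ext ::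
  "real \<Rightarrow> ((real^'n) option \<Rightarrow> (real^'n) option) \<Rightarrow> bool" where
  "K_quasiconformal_ext K F \<longleftrightarrow>
     homeomorphic_map (Alexandroff_compactification euclidean)
                      (Alexandroff_compactification euclidean) F \<and>
     (let U = {x. F (Some x) \<noteq> None}; f = (\<lambda>x. the (F (Some x)))
      in K_quasiconformal K U (f ` U) f)"

definition qc_constant :: "((real^'n) option \<Rightarrow> (real^'n) option) \<Rightarrow> real" where
  "qc_constant F = (LEAST K. K_quasiconformal_ext K F)"

text \<open>The terminology specific to the plane, \<open>CARD('n) = 2\<close>.\<close>

definition k_quasiconformal_ext ::
  "real \<Rightarrow> ((real^'n) option \<Rightarrow> (real^'n) option) \<Rightarrow> bool" where
  "k_quasiconformal_ext k F \<longleftrightarrow>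
     (\<exists>K\<ge>1. k = (K - 1) / (K + 1) \<and> K_quasiconformal_ext K F)"

section \<open>Smooth convergence to a sphere\<close>

text \<open>Surface measure of the unit sphere via polar coordinates: the measure of \<open>A\<close> is \<open>n\<close> times
  the volume of the cone \<open>{t *\<^sub>R u | t u. 0 < t < 1 \<and> u \<in> A}\<close>.\<close>

definition unit_sphere_measure :: "'a::euclidean_space measure" where
  "unit_sphere_measure =
     scale_measure (of_nat DIM('a))
       (distr (restrict_space lborel (ball 0 1 - {0})) (restrict_space borel (sphere 0 1))
          (\<lambda>x. x /\<^sub>R norm x))"

definition radial_extension :: "'a::euclidean_space set \<Rightarrow> 'a \<Rightarrow> 'a" where
  "radial_extension M x =
     (if x = 0 then 0 else norm x *\<^sub>R radial_point M (x /\<^sub>R norm x))"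

definition smoothly_converges_to_sphere :: "(real \<Rightarrow> 'a::euclidean_space set) \<Rightarrow> real \<Rightarrow> bool" where
  "smoothly_converges_to_sphere M r \<longleftrightarrow>
     ((\<lambda>t. esssup unit_sphere_measure
             (\<lambda>x. ereal (onorm (\<lambda>h. frechet_derivative (radial_extension (M t)) (at x) h - r *\<^sub>R h))))
       \<longlongrightarrow> 0) (at 0 within {0..1})"

end

theory Submission
  imports Defs
begin

text \<open>
  Let \<open>N\<close> be the gauge of \<open>M\<close>, that is the positively homogeneous function equal to \<open>1\<close> on \<open>M\<close>. Away
  from the origin the quasi-inversion is \<open>f(x) = x / N(x)\<^sup>2\<close>. As \<open>N (f(x)) = 1 / N(x)\<close>, it is an
  involution. It is continuous on the extended space, because \<open>N\<close> is continuous and comparable to the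
  norm, so it is a homeomorphism.

  The \<open>\<alpha>\<close>-tangent condition says that \<open>log r\<^sub>x\<close>, where \<open>r\<^sub>x = \<bar>x\<bar> / N(x)\<close> is the distance from the
  origin to \<open>M\<close> in the direction of \<open>x\<close>, has on the unit sphere pointwise Lipschitz constant at most \<open>\<kappa> = cot \<alpha>\<close> (\<open>star_gauge_tangential\<close>). Hence \<open>N\<close> is Lipschitz
  (\<open>star_gauge_lipschitz\<close>), \<open>f\<close> is Lipschitz on compact sets avoiding the origin and therefore
  absolutely continuous on lines, and by Rademacher's theorem (\<open>Rademacher\<close>) both are differentiable
  almost everywhere.

  Where \<open>N\<close> has a derivative \<open>N'\<close>, Euler's identity gives \<open>N' x = N(x)\<close>, and
  \<open>f'(x) h = N(x)\<^sup>-\<^sup>2 (h - 2 l(h) x)\<close> with \<open>l(h) = N' h / N(x)\<close> and \<open>l(x) = 1\<close>. The map in parentheses is a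
  reflection along \<open>x\<close> in a hyperplane that is in general not orthogonal to \<open>x\<close>. It is its own
  inverse, and on the vectors orthogonal to \<open>x\<close> the functional \<open>l\<close> is at most \<open>\<kappa> / \<bar>x\<bar>\<close>, so both the
  map and its inverse have norm at most \<open>s = \<kappa> + sqrt (1 + \<kappa>\<^sup>2)\<close> (\<open>scaled_reflection_norm_le\<close>). The
  Jacobian determinant is \<open>\<plusminus>N(x)\<^sup>-\<^sup>2\<^sup>n\<close>, and the linear dilatation is at most \<open>s\<^sup>2\<close>; for \<open>\<kappa> = cot \<alpha>\<close> one
  has \<open>s = cot (\<alpha>/2)\<close>.

  For the convergence statement, the same argument applies with any almost everywhere bound \<open>\<kappa>\<close> for
  the slope of \<open>log r\<^sub>x\<close>. If the derivative of the radial extension is within \<open>\<epsilon> < r\<close> of \<open>r\<close> times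
  the identity almost everywhere on the sphere, then \<open>\<kappa> = \<epsilon> / (r - \<epsilon>)\<close> is such a bound
  (\<open>slope_le_if_close_to_sphere\<close>), and \<open>s\<^sup>2\<close> tends to \<open>1\<close> with \<open>\<epsilon>\<close>. Dilatations are never below
  \<open>1\<close>.
\<close>

section \<open>Lipschitz functions on the line\<close>

text \<open>The push-forward of Lebesgue measure under the inverse of \<open>g\<close> gives \<open>{a..b}\<close> the mass \<open>g b - g a\<close>,
  and it is absolutely continuous because the Lipschitz map \<open>g\<close> preserves null sets. So the
  Radon-Nikodym theorem presents \<open>g\<close> as an indefinite integral.\<close>

lemma bilipschitz_has_density:
  fixes g :: "real \<Rightarrow> real"
  assumes low: "\<And>x y. x \<le> y \<Longrightarrow> y - x \<le> g y - g x"
    and upp: "\<And>x y. x \<le> y \<Longrightarrow> g y - g x \<le> C * (y - x)"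
  obtains h where "\<And>a b. a \<le> b \<Longrightarrow> (h has_integral (g b - g a)) {a..b}"
proof -
  have dist_low: "\<bar>y - x\<bar> \<le> \<bar>g y - g x\<bar>" and dist_upp: "\<bar>g y - g x\<bar> \<le> C * \<bar>y - x\<bar>" for x y
    using low[of x y] low[of y x] upp[of x y] upp[of y x] by (cases "x \<le> y"; simp)+
  have inj: "inj g"
    by (rule injI, use dist_low in \<open>metis abs_le_zero_iff diff_self eq_iff_diff_eq_0 abs_zero\<close>)
  have lip: "C-lipschitz_on UNIV g"
  proof (rule lipschitz_onI)
    show "0 \<le> C" using low[of 0 1] upp[of 0 1] by simp
  qed (use dist_upp in \<open>auto simp: dist_real_def abs_minus_commute\<close>)
  then have cont: "continuous_on S g" for S
    using lipschitz_on_continuous_on lipschitz_on_subset by blast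
  have surj: "surj g"
  proof -
    have "\<exists>x. g x = y" for y
    proof -
      let ?b = "\<bar>y - g 0\<bar>"
      have "g (- ?b) \<le> y" "y \<le> g ?b"
        using low[of 0 ?b] low[of "- ?b" 0] by auto
      then show ?thesis
        using IVT'[of g "- ?b" y ?b] cont by force
    qed
    then show ?thesis by (metis surj_def)
  qed
  define k where "k = inv g"
  have gk: "g (k y) = y" for y
    unfolding k_def by (rule surj_f_inv_f[OF surj])
  have kg: "k (g x) = x" for x
    unfolding k_def by (rule inv_f_f[OF inj])
  have "1-lipschitz_on UNIV k"
    by (rule lipschitz_onI) (use dist_low gk in \<open>auto simp: dist_real_def\<close>, metis)
  then have "continuous_on UNIV k"
    by (rule lipschitz_on_continuous_on)
  then have [measurable]: "k \<in> borel_measurable borel"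
    by (rule borel_measurable_continuous_onI)
  have vimage_k: "k -` A = g ` A" for A
    using gk kg by (auto simp: image_iff) metis
  have mono_g: "g x \<le> g y \<longleftrightarrow> x \<le> y" for x y
    using low[of x y] low[of y x] by (cases "x \<le> y") auto
  define \<mu> where "\<mu> = distr lborel borel k"
  have "absolutely_continuous lborel \<mu>"
    unfolding absolutely_continuous_def
  proof
    fix A :: "real set" assume A: "A \<in> null_sets lborel"
    then have A': "A \<in> sets borel" "negligible A"
      by (auto simp: negligible_iff_null_sets null_sets_completionI)
    have "negligible (g ` A)"
    proof (rule negligible_locally_Lipschitz_image)
      fix x show "\<exists>T B. open T \<and> x \<in> T \<and> (\<forall>y\<in>A \<inter> T. norm (g y - g x) \<le> B * norm (y - x))"
        using dist_upp by (intro exI[of _ UNIV] exI[of _ C]) auto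
    qed (use A' in auto)
    then have "k -` A \<in> null_sets lborel"
      using A' vimage_k measurable_sets[of k borel borel A]
      by (auto simp: negligible_iff_null_sets null_sets_completion_iff)
    then show "A \<in> null_sets \<mu>"
      using A' by (auto simp: \<mu>_def null_sets_def emeasure_distr)
  qed
  from sigma_finite_measure.Radon_Nikodym[OF sigma_finite_lborel this] obtain h0
    where [measurable]: "h0 \<in> borel_measurable lborel" and h0: "density lborel h0 = \<mu>"
    by (auto simp: \<mu>_def)
  have int_h0: "(\<integral>\<^sup>+x. h0 x * indicator {a..b} x \<partial>lborel) = ennreal (g b - g a)" if "a \<le> b" for a b
  proof -
    have "(\<integral>\<^sup>+x. h0 x * indicator {a..b} x \<partial>lborel) = emeasure \<mu> {a..b}"
      by (subst h0[symmetric], subst emeasure_density) auto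
    also have "\<dots> = emeasure lborel (k -` {a..b})"
      by (simp add: \<mu>_def emeasure_distr)
    also have "k -` {a..b} = {g a..g b}"
    proof -
      have "k y \<in> {a..b} \<longleftrightarrow> y \<in> {g a..g b}" for y
        using mono_g[of a "k y"] mono_g[of "k y" b] by (simp add: gk)
      then show ?thesis by auto
    qed
    finally show ?thesis
      using mono_g that by simp
  qed
  have fin: "AE x in lborel. h0 x \<noteq> \<infinity>"
  proof -
    have "AE x in lborel. h0 x * indicator {- real n..real n} x \<noteq> \<infinity>" for n
    proof (rule nn_integral_PInf_AE)
      show "(\<integral>\<^sup>+x. h0 x * indicator {- real n..real n} x \<partial>lborel) \<noteq> \<infinity>"
        by (subst int_h0) auto
    qed auto
    then have "AE x in lborel. \<forall>n. h0 x * indicator {- real n..real n} x \<noteq> \<infinity>"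
      by (simp add: AE_all_countable)
    then show ?thesis
    proof eventually_elim
      case (elim x)
      obtain n where "\<bar>x\<bar> \<le> real n" using real_arch_simple by blast
      then have "x \<in> {- real n..real n}" by auto
      then show ?case using elim[rule_format, of n] by simp
    qed
  qed
  define h where "h x = enn2real (h0 x)" for x
  have "(h has_integral (g b - g a)) {a..b}" if "a \<le> b" for a b
  proof -
    have "((\<lambda>x. h x * indicator {a..b} x) has_integral (g b - g a)) UNIV"
    proof (rule nn_integral_has_integral)
      have "(\<integral>\<^sup>+x. ennreal (h x * indicator {a..b} x) \<partial>lborel)
          = (\<integral>\<^sup>+x. h0 x * indicator {a..b} x \<partial>lborel)"
      proof (rule nn_integral_cong_AE)
        show "AE x in lborel. ennreal (h x * indicator {a..b} x) = h0 x * indicator {a..b} x"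
          using fin by eventually_elim (auto simp: h_def indicator_def top.not_eq_extremum)
      qed
      then show "(\<integral>\<^sup>+x. ennreal (h x * indicator {a..b} x) \<partial>lborel) = ennreal (g b - g a)"
        using int_h0[OF that] by simp
      show "0 \<le> g b - g a" using mono_g that by simp
    qed (auto simp: h_def)
    moreover have "(\<lambda>x. h x * indicator {a..b} x) = (\<lambda>x. if x \<in> {a..b} then h x else 0)"
      by (auto simp: indicator_def)
    ultimately show ?thesis
      by (simp only: has_integral_restrict_UNIV)
  qed
  then show thesis by (rule that)
qed

text \<open>Lebesgue's differentiation theorem for an indefinite integral. The averages over
  boxes with lower corner \<open>x\<close> give the right derivatives; the left derivatives come from the same
  averages of the reflected integrand.\<close>

lemma integral_function_differentiable_AE:
  fixes g h :: "real \<Rightarrow> real"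
  assumes h: "\<And>a b. a \<le> b \<Longrightarrow> (h has_integral (g b - g a)) {a..b}"
  shows "AE x in lebesgue. (g has_real_derivative h x) (at x)"
proof -
  have int1: "h integrable_on cbox a b" for a b
    using h[of a b] by (cases "a \<le> b") auto
  have h': "((\<lambda>x. h (- x)) has_integral (g (- a) - g (- b))) {a..b}" if "a \<le> b" for a b
    using h[of "- b" "- a"] that has_integral_reflect_real[of h _ "- a" "- b"] by simp
  have int2: "(\<lambda>x. h (- x)) integrable_on cbox a b" for a b
    using h'[of a b] by (cases "a \<le> b") auto
  obtain N where N: "negligible N"
    and Nd: "\<And>x e. \<lbrakk>x \<notin> N; 0 < e\<rbrakk> \<Longrightarrow> \<exists>d>0. \<forall>t. 0 < t \<and> t < d \<longrightarrow>
          norm (integral (cbox x (x + t *\<^sub>R One)) h /\<^sub>R t ^ DIM(real) - h x) < e"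
    using integrable_ccontinuous_explicit[OF int1] by metis
  obtain N' where N': "negligible N'"
    and Nd': "\<And>x e. \<lbrakk>x \<notin> N'; 0 < e\<rbrakk> \<Longrightarrow> \<exists>d>0. \<forall>t. 0 < t \<and> t < d \<longrightarrow>
          norm (integral (cbox x (x + t *\<^sub>R One)) (\<lambda>x. h (- x)) /\<^sub>R t ^ DIM(real) - h (- x)) < e"
    using integrable_ccontinuous_explicit[OF int2] by metis
  have "negligible (N \<union> uminus ` N')"
    using N N' by (intro negligible_Un negligible_differentiable_image_negligible)
      (auto intro: linear_imp_differentiable_on linear_uminus)
  then have "AE x in lebesgue. x \<notin> N \<union> uminus ` N'"
    unfolding negligible_iff_null_sets by (rule AE_not_in)
  then show ?thesis
  proof eventually_elim
    case (elim x)
    have "((\<lambda>t. (g (x + t) - g x) / t) \<longlongrightarrow> h x) (at 0)"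
      unfolding tendsto_iff
    proof (intro allI impI)
      fix e :: real assume "0 < e"
      obtain d1 where d1: "d1 > 0" and
        *: "\<And>t. 0 < t \<Longrightarrow> t < d1 \<Longrightarrow> \<bar>(g (x + t) - g x) / t - h x\<bar> < e"
      proof -
        from Nd[of x e] elim \<open>0 < e\<close> obtain d where "d > 0"
          and d: "\<And>t. 0 < t \<Longrightarrow> t < d \<Longrightarrow> \<bar>integral {x..x + t} h / t - h x\<bar> < e"
          by (auto simp: divide_inverse mult.commute)
        show ?thesis
        proof (rule that[OF \<open>d > 0\<close>])
          fix t assume "0 < t" "t < d"
          then show "\<bar>(g (x + t) - g x) / t - h x\<bar> < e"
            using d[of t] integral_unique[OF h[of x "x + t"]] by simp
        qed
      qed
      obtain d2 where d2: "d2 > 0" and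
        **: "\<And>t. 0 < t \<Longrightarrow> t < d2 \<Longrightarrow> \<bar>(g x - g (x - t)) / t - h x\<bar> < e"
      proof -
        have "- x \<notin> N'" using elim by force
        from Nd'[OF this \<open>0 < e\<close>] obtain d where "d > 0"
          and d: "\<And>t. 0 < t \<Longrightarrow> t < d \<Longrightarrow> \<bar>integral {- x..- x + t} (\<lambda>x. h (- x)) / t - h x\<bar> < e"
          by (auto simp: divide_inverse mult.commute)
        show ?thesis
        proof (rule that[OF \<open>d > 0\<close>])
          fix t assume "0 < t" "t < d"
          then show "\<bar>(g x - g (x - t)) / t - h x\<bar> < e"
            using d[of t] integral_unique[OF h'[of "- x" "- x + t"]] by simp
        qed
      qed
      show "\<forall>\<^sub>F t in at 0. dist ((g (x + t) - g x) / t) (h x) < e"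
        unfolding eventually_at
      proof (intro exI[of _ "min d1 d2"] conjI ballI impI)
        fix t :: real assume t: "t \<noteq> 0 \<and> dist t 0 < min d1 d2"
        show "dist ((g (x + t) - g x) / t) (h x) < e"
        proof (cases "t > 0")
          case True
          then show ?thesis using *[of t] t by (simp add: dist_real_def)
        next
          case False
          have "(g (x + t) - g x) / t = (g x - g (x - (- t))) / (- t)"
            by (simp add: minus_divide_left add.commute)
          then show ?thesis using **[of "- t"] t False by (simp add: dist_real_def)
        qed
      qed (use d1 d2 in auto)
    qed
    then show ?case by (simp add: DERIV_def)
  qed
qed

text \<open>Adding a multiple of the identity makes \<open>f\<close> strictly increasing and bilipschitz.\<close>

lemma lipschitz_real_differentiable_AE:
  fixes f :: "real \<Rightarrow> real"
  assumes "L-lipschitz_on UNIV f"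
  shows "AE x in lebesgue. f differentiable at x"
proof -
  define g where "g x = f x + (L + 1) * x" for x
  have f: "\<bar>f y - f x\<bar> \<le> L * (y - x)" if "x \<le> y" for x y
    using lipschitz_onD[OF assms, of y x] that by (simp add: dist_real_def)
  obtain h where h: "\<And>a b. a \<le> b \<Longrightarrow> (h has_integral (g b - g a)) {a..b}"
  proof (rule bilipschitz_has_density[of g "2 * L + 1"])
    fix x y :: real assume "x \<le> y"
    from f[OF this] show "y - x \<le> g y - g x" "g y - g x \<le> (2 * L + 1) * (y - x)"
      by (auto simp: g_def algebra_simps)
  qed auto
  have "AE x in lebesgue. (g has_real_derivative h x) (at x)"
    by (rule integral_function_differentiable_AE) (rule h)
  then show ?thesis
  proof eventually_elim
    case (elim x)
    then have "((\<lambda>x. g x - (L + 1) * x) has_real_derivative h x - (L + 1)) (at x)"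
      by (auto intro!: derivative_eq_intros)
    then show ?case
      by (auto simp: g_def differentiable_def has_field_derivative_def)
  qed
qed

section \<open>Rademacher's theorem\<close>

text \<open>Fubini in an arbitrary direction \<open>v\<close>, with no change of coordinates: integrate
  \<open>indicator A (x + t *\<^sub>R v)\<close> over \<open>x\<close> and \<open>t \<in> {0..1}\<close>. Integrating in \<open>x\<close> first gives the measure of
  \<open>A\<close> by translation invariance, integrating in \<open>t\<close> first gives \<open>0\<close>.\<close>

lemma null_sets_if_null_on_lines:
  fixes A :: "'a::euclidean_space set"
  assumes [measurable]: "A \<in> sets borel"
    and line: "\<And>x. AE t in lborel. x + t *\<^sub>R v \<notin> A"
  shows "A \<in> null_sets lborel"
proof -
  have "(\<integral>\<^sup>+t. \<integral>\<^sup>+x. indicator {0..1::real} t * indicator A (x + t *\<^sub>R v) \<partial>lborel \<partial>lborel)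
      = (\<integral>\<^sup>+t. indicator {0..1::real} t * emeasure lborel A \<partial>lborel)"
  proof (rule nn_integral_cong)
    fix t :: real
    have "(\<integral>\<^sup>+x. indicator A (x + t *\<^sub>R v) \<partial>lborel) = (\<integral>\<^sup>+x. indicator A x \<partial>distr lborel borel ((+) (t *\<^sub>R v)))"
      by (subst nn_integral_distr) (auto simp: add.commute)
    also have "\<dots> = emeasure lborel A"
      by (simp add: lborel_distr_plus)
    finally show "(\<integral>\<^sup>+x. indicator {0..1::real} t * indicator A (x + t *\<^sub>R v) \<partial>lborel)
        = indicator {0..1} t * emeasure lborel A"
      by (subst nn_integral_cmult) auto
  qed
  also have "\<dots> = emeasure lborel A"
    by (subst nn_integral_multc) auto
  finally have "emeasure lborel A
      = (\<integral>\<^sup>+t. \<integral>\<^sup>+x. indicator {0..1::real} t * indicator A (x + t *\<^sub>R v) \<partial>lborel \<partial>lborel)" ..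
  also have "\<dots> = (\<integral>\<^sup>+x. \<integral>\<^sup>+t. indicator {0..1::real} t * indicator A (x + t *\<^sub>R v) \<partial>lborel \<partial>lborel)"
    by (rule lborel_pair.Fubini') measurable
  also have "\<dots> = (\<integral>\<^sup>+x. 0 \<partial>(lborel :: 'a measure))"
  proof (rule nn_integral_cong)
    fix x
    have "(\<integral>\<^sup>+t. indicator {0..1::real} t * indicator A (x + t *\<^sub>R v) \<partial>lborel) = (\<integral>\<^sup>+t. 0 \<partial>(lborel :: real measure))"
      by (rule nn_integral_cong_AE) (use line[of x] in eventually_elim, auto)
    then show "(\<integral>\<^sup>+t. indicator {0..1::real} t * indicator A (x + t *\<^sub>R v) \<partial>lborel) = 0" by simp
  qed
  finally show ?thesis by (auto simp: null_sets_def)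
qed

text \<open>The Cauchy criterion, written with quantifiers over natural numbers wherever the bounds are
  concerned, so that it can be read as a countable combination of sets.\<close>

lemma tendsto_at_0_iff_Cauchy:
  fixes q :: "real \<Rightarrow> real"
  shows "(\<exists>d. (q \<longlongrightarrow> d) (at 0)) \<longleftrightarrow>
    (\<forall>k. \<exists>m. \<forall>s t. 0 < \<bar>s\<bar> \<and> \<bar>s\<bar> < inverse (real (Suc m)) \<and> 0 < \<bar>t\<bar> \<and> \<bar>t\<bar> < inverse (real (Suc m))
        \<longrightarrow> \<bar>q s - q t\<bar> \<le> inverse (real (Suc k)))" (is "?lhs \<longleftrightarrow> ?rhs")
proof
  assume ?lhs
  then obtain d where d: "(q \<longlongrightarrow> d) (at 0)" ..
  show ?rhs
  proof
    fix k
    have "inverse (real (Suc k)) / 2 > 0" by simp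
    with d obtain r where "r > 0" and r: "\<And>t. t \<noteq> 0 \<Longrightarrow> \<bar>t\<bar> < r \<Longrightarrow> \<bar>q t - d\<bar> < inverse (real (Suc k)) / 2"
      unfolding tendsto_iff eventually_at dist_real_def by (metis UNIV_I diff_zero)
    obtain m where m: "inverse (real (Suc m)) < r" using reals_Archimedean[OF \<open>r > 0\<close>] by blast
    have "\<bar>q s - q t\<bar> \<le> inverse (real (Suc k))"
      if "0 < \<bar>s\<bar>" "\<bar>s\<bar> < inverse (real (Suc m))" "0 < \<bar>t\<bar>" "\<bar>t\<bar> < inverse (real (Suc m))" for s t
      using r[of s] r[of t] that m by linarith
    then show "\<exists>m. \<forall>s t. 0 < \<bar>s\<bar> \<and> \<bar>s\<bar> < inverse (real (Suc m)) \<and> 0 < \<bar>t\<bar> \<and> \<bar>t\<bar> < inverse (real (Suc m))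
        \<longrightarrow> \<bar>q s - q t\<bar> \<le> inverse (real (Suc k))" by blast
  qed
next
  assume R: ?rhs
  define a where "a n = q (inverse (real (Suc n)))" for n
  have small: "inverse (real (Suc n)) < inverse (real (Suc m))" if "n > m" for m n
    using that by (simp add: field_simps)
  have "Cauchy a"
  proof (rule metric_CauchyI)
    fix e :: real assume "e > 0"
    obtain k where k: "inverse (real (Suc k)) < e" using reals_Archimedean[OF \<open>e > 0\<close>] by blast
    obtain m where m: "\<And>s t. 0 < \<bar>s\<bar> \<Longrightarrow> \<bar>s\<bar> < inverse (real (Suc m)) \<Longrightarrow> 0 < \<bar>t\<bar> \<Longrightarrow> \<bar>t\<bar> < inverse (real (Suc m))
        \<Longrightarrow> \<bar>q s - q t\<bar> \<le> inverse (real (Suc k))" using R by metis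
    show "\<exists>M. \<forall>m\<ge>M. \<forall>n\<ge>M. dist (a m) (a n) < e"
    proof (intro exI[of _ "Suc m"] allI impI)
      fix i j assume "i \<ge> Suc m" "j \<ge> Suc m"
      then have "\<bar>a i - a j\<bar> \<le> inverse (real (Suc k))"
        unfolding a_def by (intro m) (use small[of m i] small[of m j] in auto)
      then show "dist (a i) (a j) < e" using k by (simp add: dist_real_def)
    qed
  qed
  then obtain d where d: "a \<longlonglongrightarrow> d"
    using convergent_eq_Cauchy by blast
  have "(q \<longlongrightarrow> d) (at 0)"
    unfolding tendsto_iff
  proof (intro allI impI)
    fix e :: real assume "e > 0"
    obtain k where k: "inverse (real (Suc k)) < e" using reals_Archimedean[OF \<open>e > 0\<close>] by blast
    obtain m where m: "\<And>s t. 0 < \<bar>s\<bar> \<Longrightarrow> \<bar>s\<bar> < inverse (real (Suc m)) \<Longrightarrow> 0 < \<bar>t\<bar> \<Longrightarrow> \<bar>t\<bar> < inverse (real (Suc m))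
        \<Longrightarrow> \<bar>q s - q t\<bar> \<le> inverse (real (Suc k))" using R by metis
    show "\<forall>\<^sub>F t in at 0. dist (q t) d < e"
      unfolding eventually_at
    proof (intro exI[of _ "inverse (real (Suc m))"] conjI ballI impI)
      fix t :: real assume t: "t \<noteq> 0 \<and> dist t 0 < inverse (real (Suc m))"
      have "(\<lambda>n. \<bar>q t - a n\<bar>) \<longlonglongrightarrow> \<bar>q t - d\<bar>"
        by (intro tendsto_intros d)
      moreover have "\<bar>q t - a n\<bar> \<le> inverse (real (Suc k))" if "n \<ge> Suc m" for n
        unfolding a_def by (intro m) (use t small[of m n] that in auto)
      ultimately have "\<bar>q t - d\<bar> \<le> inverse (real (Suc k))"
        by (intro LIMSEQ_le_const2) auto
      then show "dist (q t) d < e" using k by (simp add: dist_real_def)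
    qed auto
  qed
  then show ?lhs ..
qed

text \<open>The quantifiers over the real increments \<open>s\<close>, \<open>t\<close> in the Cauchy criterion cost nothing: by
  continuity of \<open>f\<close> they amount to an intersection of closed sets.\<close>

lemma borel_directionally_differentiable:
  fixes f :: "'a::euclidean_space \<Rightarrow> real"
  assumes cont: "continuous_on UNIV f"
  shows "{x. \<exists>d. ((\<lambda>t. f (x + t *\<^sub>R v)) has_real_derivative d) (at 0)} \<in> sets borel"
proof -
  define q where "q x t = (f (x + t *\<^sub>R v) - f x) / t" for x t
  define P where "P m s t \<longleftrightarrow> 0 < \<bar>s\<bar> \<and> \<bar>s\<bar> < inverse (real (Suc m)) \<and> 0 < \<bar>t\<bar> \<and> \<bar>t\<bar> < inverse (real (Suc m))"
    for m and s t :: real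
  define G where "G k m = {x. \<forall>s t. P m s t \<longrightarrow> \<bar>q x s - q x t\<bar> \<le> inverse (real (Suc k))}" for k m
  have "(\<exists>d. ((\<lambda>t. f (x + t *\<^sub>R v)) has_real_derivative d) (at 0)) \<longleftrightarrow> (\<exists>d. (q x \<longlongrightarrow> d) (at 0))" for x
    by (simp add: DERIV_def q_def[abs_def])
  then have "{x. \<exists>d. ((\<lambda>t. f (x + t *\<^sub>R v)) has_real_derivative d) (at 0)} = (\<Inter>k. \<Union>m. G k m)"
    unfolding tendsto_at_0_iff_Cauchy G_def P_def by simp blast
  moreover have "closed (G k m)" for k m
  proof -
    have "closed {x. P m s t \<longrightarrow> \<bar>q x s - q x t\<bar> \<le> inverse (real (Suc k))}" for s t
    proof (cases "P m s t")
      case True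
      then have "s \<noteq> 0" "t \<noteq> 0" by (auto simp: P_def)
      then have "closed {x. \<bar>q x s - q x t\<bar> \<le> inverse (real (Suc k))}"
        unfolding q_def by (intro closed_Collect_le continuous_intros continuous_on_compose2[OF cont]) auto
      then show ?thesis using True by simp
    qed simp
    then show ?thesis unfolding G_def by (intro closed_Collect_all)
  qed
  then have "(\<Inter>k. \<Union>m. G k m) \<in> sets borel"
    by (intro sets.countable_INT'' sets.countable_UN) auto
  ultimately show ?thesis by simp
qed

text \<open>Difference quotient of \<open>f\<close> at \<open>x\<close> in direction \<open>v\<close> for the increment \<open>1 / (n + 1)\<close>.\<close>

definition dirquot :: "('a::euclidean_space \<Rightarrow> real) \<Rightarrow> 'a \<Rightarrow> nat \<Rightarrow> 'a \<Rightarrow> real" where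
  "dirquot f v n x = (f (x + inverse (real (Suc n)) *\<^sub>R v) - f x) * real (Suc n)"

text \<open>The directional derivative. It is taken along the increments \<open>1 / (n + 1)\<close> only, which makes it
  a Borel function of \<open>x\<close>; where the quotients diverge it has an arbitrary value.\<close>

definition dirderiv :: "('a::euclidean_space \<Rightarrow> real) \<Rightarrow> 'a \<Rightarrow> 'a \<Rightarrow> real" where
  "dirderiv f v x = lim (\<lambda>n. dirquot f v n x)"

lemma dirquot_tendsto:
  assumes "((\<lambda>t. f (x + t *\<^sub>R v)) has_real_derivative d) (at 0)"
  shows "(\<lambda>n. dirquot f v n x) \<longlonglongrightarrow> d"
proof -
  have "((\<lambda>t. (f (x + t *\<^sub>R v) - f x) / t) \<longlongrightarrow> d) (at 0)"
    using assms by (simp add: DERIV_def)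
  moreover have "filterlim (\<lambda>n. inverse (real (Suc n))) (at 0) sequentially"
    by (simp add: filterlim_at LIMSEQ_inverse_real_of_nat del: of_nat_Suc)
  ultimately have "((\<lambda>n. (f (x + inverse (real (Suc n)) *\<^sub>R v) - f x) / inverse (real (Suc n))) \<longlonglongrightarrow> d)"
    by (rule filterlim_compose)
  then show ?thesis by (simp add: dirquot_def divide_inverse del: of_nat_Suc)
qed

lemma dirderiv_eq:
  assumes "((\<lambda>t. f (x + t *\<^sub>R v)) has_real_derivative d) (at 0)"
  shows "dirderiv f v x = d"
  unfolding dirderiv_def using dirquot_tendsto[OF assms] by (rule limI)

lemma dirderiv_scaleR:
  assumes "((\<lambda>t. f (x + t *\<^sub>R v)) has_real_derivative d) (at 0)"
  shows "dirderiv f (c *\<^sub>R v) x = c * d"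
proof (rule dirderiv_eq)
  have "((\<lambda>t. f (x + t *\<^sub>R v)) has_real_derivative d) (at (0 * c))"
    using assms by simp
  then have "((\<lambda>t. f (x + (t * c) *\<^sub>R v)) has_real_derivative d * c) (at 0)"
    by (rule DERIV_chain2) (auto intro!: derivative_eq_intros)
  then show "((\<lambda>t. f (x + t *\<^sub>R c *\<^sub>R v)) has_real_derivative c * d) (at 0)"
    by (simp add: mult.commute)
qed

context
  fixes f :: "'a::euclidean_space \<Rightarrow> real" and L :: real
  assumes lip: "L-lipschitz_on UNIV f"
begin

lemma lipschitz_cont: "continuous_on S f"
  using lip lipschitz_on_continuous_on lipschitz_on_subset by blast

lemma lipschitz_bound: "\<bar>f x - f y\<bar> \<le> L * norm (x - y)"
  using lipschitz_onD[OF lip, of x y] by (simp add: dist_real_def dist_norm)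

lemma lipschitz_directionally_differentiable_AE:
  "AE x in lborel. ((\<lambda>t. f (x + t *\<^sub>R v)) has_real_derivative dirderiv f v x) (at 0)"
proof -
  let ?G = "{x. \<exists>d. ((\<lambda>t. f (x + t *\<^sub>R v)) has_real_derivative d) (at 0)}"
  have "- ?G \<in> null_sets lborel"
  proof (rule null_sets_if_null_on_lines[where v = v])
    show "- ?G \<in> sets borel"
      using borel_directionally_differentiable[OF lipschitz_cont, of v] by (metis borel_comp)
    fix x
    have "(L * norm v)-lipschitz_on UNIV (\<lambda>t. f (x + t *\<^sub>R v))"
    proof (rule lipschitz_onI)
      fix s t :: real
      show "dist (f (x + s *\<^sub>R v)) (f (x + t *\<^sub>R v)) \<le> L * norm v * dist s t"
        using lipschitz_bound[of "x + s *\<^sub>R v" "x + t *\<^sub>R v"]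
        by (simp add: dist_real_def mult_ac flip: scaleR_diff_left)
    qed (use lipschitz_on_nonneg[OF lip] in auto)
    then have "AE t in lebesgue. (\<lambda>t. f (x + t *\<^sub>R v)) differentiable at t"
      by (rule lipschitz_real_differentiable_AE)
    then have "AE t in lborel. (\<lambda>t. f (x + t *\<^sub>R v)) differentiable at t"
      by (simp add: AE_completion_iff)
    then show "AE t in lborel. x + t *\<^sub>R v \<notin> - ?G"
    proof eventually_elim
      case (elim t)
      then obtain d where "((\<lambda>t. f (x + t *\<^sub>R v)) has_real_derivative d) (at t)"
        using real_differentiable_def by blast
      then have "((\<lambda>s. f (x + (t + s) *\<^sub>R v)) has_real_derivative d) (at 0)"
        using DERIV_shift[of "\<lambda>t. f (x + t *\<^sub>R v)" d 0 t] by (simp add: add.commute)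
      then show ?case
        by (auto simp: scaleR_left_distrib add.assoc)
    qed
  qed
  then have "AE x in lborel. x \<notin> - ?G"
    by (rule AE_not_in)
  then show ?thesis
    by eventually_elim (use dirderiv_eq in blast)
qed

lemma dirquot_measurable [measurable]: "dirquot f v n \<in> borel_measurable borel"
proof -
  have [measurable]: "f \<in> borel_measurable borel"
    by (rule borel_measurable_continuous_onI[OF lipschitz_cont])
  show ?thesis unfolding dirquot_def[abs_def] by measurable
qed

lemma dirderiv_measurable [measurable]: "dirderiv f v \<in> borel_measurable borel"
  unfolding dirderiv_def[abs_def] by measurable

lemma dirquot_bounded: "\<bar>dirquot f v n x\<bar> \<le> L * norm v"
  using lipschitz_bound[of "x + inverse (real (Suc n)) *\<^sub>R v" x]
  by (simp add: dirquot_def abs_mult divide_simps mult.commute del: of_nat_Suc)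

lemma dirquot_tendsto_dirderiv_AE: "AE x in lborel. (\<lambda>n. dirquot f v n x) \<longlonglongrightarrow> dirderiv f v x"
  using lipschitz_directionally_differentiable_AE
  by eventually_elim (rule dirquot_tendsto)

text \<open>The box is translated by the null sequence \<open>u\<close>, as needed below for the additivity in the
  direction; \<open>u = 0\<close> is the plain case.\<close>

lemma integral_dirquot_tendsto:
  fixes u :: "nat \<Rightarrow> 'a"
  assumes u: "u \<longlonglongrightarrow> 0"
  shows "integrable lborel (\<lambda>x. indicator (cbox a b) (x - u n) * dirquot f v n x)"
    and "integrable lborel (\<lambda>x. indicator (cbox a b) x * dirderiv f v x)"
    and "(\<lambda>n. \<integral>x. indicator (cbox a b) (x - u n) * dirquot f v n x \<partial>lborel)
      \<longlonglongrightarrow> (\<integral>x. indicator (cbox a b) x * dirderiv f v x \<partial>lborel)"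
proof -
  obtain r where r: "\<And>n. norm (u n) \<le> r"
    using convergent_imp_Bseq[OF convergentI[OF u]] by (auto simp: Bseq_def)
  obtain s where s: "\<And>x. x \<in> cbox a b \<Longrightarrow> norm x \<le> s"
    using bounded_cbox[of a b] by (auto simp: bounded_iff)
  \<comment> \<open>Off the null set \<open>frontier (cbox a b)\<close> the translated indicators converge.\<close>
  have frontier: "AE x in lborel. x \<notin> frontier (cbox a b)"
  proof -
    have "frontier (cbox a b) \<in> null_sets lebesgue"
      using negligible_convex_frontier[OF convex_box(1)] by (simp add: negligible_iff_null_sets)
    then have "AE x in lebesgue. x \<notin> frontier (cbox a b)" by (rule AE_not_in)
    then show ?thesis by (simp add: AE_completion_iff)
  qed
  have lim: "AE x in lborel. (\<lambda>n. indicator (cbox a b) (x - u n) * dirquot f v n x)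
      \<longlonglongrightarrow> indicator (cbox a b) x * dirderiv f v x"
    using frontier dirquot_tendsto_dirderiv_AE[of v]
  proof eventually_elim
    case (elim x)
    have "isCont (indicator (cbox a b) :: 'a \<Rightarrow> real) x"
      using elim(1) isCont_indicator by blast
    moreover have "(\<lambda>n. x - u n) \<longlonglongrightarrow> x"
      using tendsto_diff[OF tendsto_const u, of x] by simp
    ultimately have "(\<lambda>n. indicator (cbox a b) (x - u n) :: real) \<longlonglongrightarrow> indicator (cbox a b) x"
      by (rule isCont_tendsto_compose)
    with elim(2) show ?case by (rule tendsto_mult[rotated])
  qed
  have dom: "norm (indicator (cbox a b) (x - u n) * dirquot f v n x)
      \<le> indicator (cball 0 (r + s)) x * (L * norm v)" for x n
  proof (cases "x - u n \<in> cbox a b")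
    case True
    then have "norm (x - u n) \<le> s" using s by auto
    then have "norm x \<le> r + s" using r[of n] norm_triangle_sub[of x "u n"] by linarith
    then show ?thesis using True dirquot_bounded by simp
  next
    case False
    then show ?thesis using lipschitz_on_nonneg[OF lip] by (simp add: indicator_def)
  qed
  have "integrable lborel (\<lambda>x. indicator (cball (0::'a) (r + s)) x * (L * norm v) :: real)"
    by (intro integrable_mult_left integrable_real_indicator)
      (use emeasure_bounded_finite[OF bounded_cball, of "0 :: 'a" "r + s"] in auto)
  note * = this
  show "integrable lborel (\<lambda>x. indicator (cbox a b) (x - u n) * dirquot f v n x)"
  proof (rule Bochner_Integration.integrable_bound[OF *])
    show "AE x in lborel. norm (indicator (cbox a b) (x - u n) * dirquot f v n x)
        \<le> norm (indicator (cball 0 (r + s)) x * (L * norm v) :: real)"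
      using dom[of _ n] by (intro AE_I2) (metis abs_ge_self order_trans real_norm_def)
  qed measurable
  show "integrable lborel (\<lambda>x. indicator (cbox a b) x * dirderiv f v x)"
    by (rule integrable_dominated_convergence[OF _ _ * lim]) (use dom in auto)
  show "(\<lambda>n. \<integral>x. indicator (cbox a b) (x - u n) * dirquot f v n x \<partial>lborel)
      \<longlonglongrightarrow> (\<integral>x. indicator (cbox a b) x * dirderiv f v x \<partial>lborel)"
    by (rule integral_dominated_convergence[OF _ _ * lim]) (use dom in auto)
qed

lemma dirquot_add:
  "dirquot f (v + w) n x = dirquot f v n x + dirquot f w n (x + inverse (real (Suc n)) *\<^sub>R v)"
  by (simp add: dirquot_def algebra_simps)

text \<open>The quotient in direction \<open>v + w\<close> is the quotient in direction \<open>v\<close> plus the one in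
  direction \<open>w\<close> at a point shifted by a small multiple of \<open>v\<close>. After integration over a box the
  shift moves to the box, where it disappears in the limit. So the defect of additivity has integral
  \<open>0\<close> over every box and vanishes almost everywhere.\<close>

lemma dirderiv_add_AE: "AE x in lborel. dirderiv f (v + w) x = dirderiv f v x + dirderiv f w x"
proof -
  define h where "h x = dirderiv f (v + w) x - dirderiv f v x - dirderiv f w x" for x
  have hint: "(h has_integral 0) (cbox a b)" for a b
  proof -
    let ?I = "\<lambda>x. indicator (cbox a b) x :: real"
    define u where "u n = inverse (real (Suc n)) *\<^sub>R v" for n
    have u: "u \<longlonglongrightarrow> 0"
      unfolding u_def using tendsto_scaleR[OF LIMSEQ_inverse_real_of_nat tendsto_const, of v] by simp
    note z = tendsto_const[of "0 :: 'a" sequentially]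
    note int = integral_dirquot_tendsto(1)[OF z, of a b, simplified]
      integral_dirquot_tendsto(2)[OF z, of a b]
    have shift: "(\<integral>x. ?I x * dirquot f w n (x + u n) \<partial>lborel) = (\<integral>x. ?I (x - u n) * dirquot f w n x \<partial>lborel)"
      and shift_int: "integrable lborel (\<lambda>x. ?I x * dirquot f w n (x + u n))" for n
    proof -
      have eq: "?I x * dirquot f w n (x + u n) = (\<lambda>x. ?I (x - u n) * dirquot f w n x) (u n + x)" for x
        by (simp add: add.commute)
      show "(\<integral>x. ?I x * dirquot f w n (x + u n) \<partial>lborel) = (\<integral>x. ?I (x - u n) * dirquot f w n x \<partial>lborel)"
        unfolding eq by (subst (2) lborel_distr_plus[of "u n", symmetric], subst integral_distr) auto
      have "integrable (distr lborel borel ((+) (u n))) (\<lambda>x. ?I (x - u n) * dirquot f w n x)"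
        using integral_dirquot_tendsto(1)[OF u] by (simp add: lborel_distr_plus)
      then show "integrable lborel (\<lambda>x. ?I x * dirquot f w n (x + u n))"
        unfolding eq by (subst (asm) integrable_distr_eq) auto
    qed
    have "(\<lambda>n. (\<integral>x. ?I x * dirquot f v n x \<partial>lborel) + (\<integral>x. ?I (x - u n) * dirquot f w n x \<partial>lborel))
        \<longlonglongrightarrow> (\<integral>x. ?I x * dirderiv f v x \<partial>lborel) + (\<integral>x. ?I x * dirderiv f w x \<partial>lborel)"
      using integral_dirquot_tendsto(3)[OF z, of a b v] integral_dirquot_tendsto(3)[OF u, of a b w]
      by (intro tendsto_add) auto
    also have "(\<lambda>n. (\<integral>x. ?I x * dirquot f v n x \<partial>lborel) + (\<integral>x. ?I (x - u n) * dirquot f w n x \<partial>lborel))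
        = (\<lambda>n. \<integral>x. ?I x * dirquot f (v + w) n x \<partial>lborel)"
    proof
      fix n
      have "(\<integral>x. ?I x * dirquot f (v + w) n x \<partial>lborel)
          = (\<integral>x. ?I x * dirquot f v n x + ?I x * dirquot f w n (x + u n) \<partial>lborel)"
        by (simp add: dirquot_add u_def distrib_left)
      also have "\<dots> = (\<integral>x. ?I x * dirquot f v n x \<partial>lborel) + (\<integral>x. ?I x * dirquot f w n (x + u n) \<partial>lborel)"
        by (rule Bochner_Integration.integral_add[OF int(1) shift_int])
      finally show "(\<integral>x. ?I x * dirquot f v n x \<partial>lborel) + (\<integral>x. ?I (x - u n) * dirquot f w n x \<partial>lborel)
          = (\<integral>x. ?I x * dirquot f (v + w) n x \<partial>lborel)"
        by (simp only: shift)
    qed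
    finally have "(\<integral>x. ?I x * dirderiv f (v + w) x \<partial>lborel)
        = (\<integral>x. ?I x * dirderiv f v x \<partial>lborel) + (\<integral>x. ?I x * dirderiv f w x \<partial>lborel)"
      using integral_dirquot_tendsto(3)[OF z, of a b "v + w"] by (auto intro: LIMSEQ_unique)
    then have "(\<integral>x. ?I x * h x \<partial>lborel) = 0"
      using int by (simp add: h_def right_diff_distrib)
    moreover have "integrable lborel (\<lambda>x. ?I x * h x)"
      using int by (simp add: h_def right_diff_distrib)
    ultimately have "((\<lambda>x. ?I x * h x) has_integral 0) UNIV"
      using has_integral_integral_lborel by metis
    moreover have "(\<lambda>x. ?I x * h x) = (\<lambda>x. if x \<in> cbox a b then h x else 0)"
      by (auto simp: indicator_def)
    ultimately show ?thesis
      by (simp only: has_integral_restrict_UNIV)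
  qed
  obtain N where N: "negligible N"
    and Nd: "\<And>x e. \<lbrakk>x \<notin> N; 0 < e\<rbrakk> \<Longrightarrow> \<exists>d>0. \<forall>t. 0 < t \<and> t < d \<longrightarrow>
          norm (integral (cbox x (x + t *\<^sub>R One)) h /\<^sub>R t ^ DIM('a) - h x) < e"
    using integrable_ccontinuous_explicit[OF has_integral_integrable[OF hint]] by metis
  have "AE x in lebesgue. x \<notin> N"
    using N unfolding negligible_iff_null_sets by (rule AE_not_in)
  then have "AE x in lebesgue. dirderiv f (v + w) x = dirderiv f v x + dirderiv f w x"
  proof eventually_elim
    case (elim x)
    have "\<bar>h x\<bar> < e" if e: "e > 0" for e
    proof -
      obtain d where "d > 0" and d: "\<And>t. 0 < t \<Longrightarrow> t < d \<Longrightarrow>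
          norm (integral (cbox x (x + t *\<^sub>R One)) h /\<^sub>R t ^ DIM('a) - h x) < e"
        using Nd[OF elim e] by blast
      then show ?thesis
        using d[of "d / 2"] integral_unique[OF hint] by simp
    qed
    then have "h x = 0"
      by (metis less_irrefl zero_less_abs_iff)
    then show ?case by (simp add: h_def)
  qed
  then show ?thesis by (simp add: AE_completion_iff)
qed

lemma dirderiv_linear_AE:
  "AE x in lborel. dirderiv f v x = (\<Sum>b\<in>Basis. (v \<bullet> b) * dirderiv f b x)"
proof -
  have "AE x in lborel. dirderiv f (\<Sum>b\<in>F. (v \<bullet> b) *\<^sub>R b) x = (\<Sum>b\<in>F. (v \<bullet> b) * dirderiv f b x)"
    if "finite F" for F
    using that
  proof induction
    case empty
    have "dirderiv f 0 x = 0" for x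
      by (rule dirderiv_eq) simp
    then show ?case by simp
  next
    case (insert b F)
    from insert.IH dirderiv_add_AE[of "(v \<bullet> b) *\<^sub>R b" "\<Sum>b\<in>F. (v \<bullet> b) *\<^sub>R b"]
      lipschitz_directionally_differentiable_AE[of b]
    show ?case
      by eventually_elim (use insert.hyps in \<open>simp add: dirderiv_scaleR\<close>)
  qed
  from this[OF finite_Basis] show ?thesis
    by (simp add: euclidean_representation)
qed

text \<open>By compactness finitely many directions are \<open>\<eta>\<close>-dense in the unit sphere, so finitely many
  directional limits control all increments, up to the Lipschitz constant.\<close>

lemma differentiable_if_dense_directions:
  fixes D :: "'a set" and T :: "'a \<Rightarrow> real"
  assumes dense: "\<And>X. open X \<Longrightarrow> X \<noteq> {} \<Longrightarrow> \<exists>d\<in>D. d \<in> X"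
    and T: "bounded_linear T"
    and der: "\<And>v. v \<in> D \<Longrightarrow> ((\<lambda>t. f (x + t *\<^sub>R v)) has_real_derivative T v) (at 0)"
  shows "(f has_derivative T) (at x)"
  unfolding has_derivative_at_alt
proof (intro conjI T allI impI)
  fix e :: real assume "e > 0"
  interpret T: bounded_linear T by fact
  obtain C where "C > 0" and C: "\<And>v. norm (T v) \<le> norm v * C"
    using T.pos_bounded by auto
  have L: "L \<ge> 0" by (rule lipschitz_on_nonneg[OF lip])
  define \<eta> where "\<eta> = e / (L + 1 + C)"
  have "\<eta> > 0" using \<open>e > 0\<close> \<open>C > 0\<close> L by (simp add: \<eta>_def)
  have "sphere 0 1 \<subseteq> (\<Union>v\<in>D. ball v \<eta>)"
  proof
    fix u :: 'a
    obtain v where "v \<in> D" "v \<in> ball u \<eta>" using dense[of "ball u \<eta>"] \<open>\<eta> > 0\<close> by auto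
    then show "u \<in> (\<Union>v\<in>D. ball v \<eta>)" by (auto simp: dist_commute)
  qed
  then obtain F where F: "F \<subseteq> D" "finite F" "sphere 0 1 \<subseteq> (\<Union>v\<in>F. ball v \<eta>)"
    using compactE_image[OF compact_sphere, of D "\<lambda>v. ball v \<eta>" 0 1] by auto
  have "\<forall>v\<in>F. \<exists>d>0. \<forall>t. \<bar>t\<bar> < d \<longrightarrow> \<bar>f (x + t *\<^sub>R v) - f x - t * T v\<bar> \<le> \<eta> * \<bar>t\<bar>"
  proof
    fix v assume "v \<in> F"
    then have "((\<lambda>t. f (x + t *\<^sub>R v)) has_derivative (\<lambda>t. t * T v)) (at 0)"
      using der[of v] F by (auto simp: has_field_derivative_def mult_commute_abs)
    then show "\<exists>d>0. \<forall>t. \<bar>t\<bar> < d \<longrightarrow> \<bar>f (x + t *\<^sub>R v) - f x - t * T v\<bar> \<le> \<eta> * \<bar>t\<bar>"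
      using \<open>\<eta> > 0\<close> unfolding has_derivative_at_alt by auto
  qed
  then obtain d where d: "\<And>v. v \<in> F \<Longrightarrow> d v > 0"
    "\<And>v t. v \<in> F \<Longrightarrow> \<bar>t\<bar> < d v \<Longrightarrow> \<bar>f (x + t *\<^sub>R v) - f x - t * T v\<bar> \<le> \<eta> * \<bar>t\<bar>"
    by metis
  define \<delta> where "\<delta> = Min (insert 1 (d ` F))"
  have "\<delta> > 0" using F d by (auto simp: \<delta>_def)
  have \<delta>: "\<delta> \<le> d v" if "v \<in> F" for v using F that by (auto simp: \<delta>_def)
  show "\<exists>d>0. \<forall>y. norm (y - x) < d \<longrightarrow> norm (f y - f x - T (y - x)) \<le> e * norm (y - x)"
  proof (intro exI[of _ \<delta>] conjI allI impI \<open>\<delta> > 0\<close>)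
    fix y assume y: "norm (y - x) < \<delta>"
    define t where "t = norm (y - x)"
    show "norm (f y - f x - T (y - x)) \<le> e * norm (y - x)"
    proof (cases "y = x")
      case False
      then have "t > 0" by (simp add: t_def)
      define u where "u = (y - x) /\<^sub>R t"
      have yx: "y = x + t *\<^sub>R u" using \<open>t > 0\<close> by (simp add: u_def)
      have "u \<in> sphere 0 1" using \<open>t > 0\<close> by (simp add: u_def t_def)
      then obtain v where "v \<in> F" and v: "norm (u - v) < \<eta>"
        using F by (force simp: dist_norm norm_minus_commute)
      have "\<bar>f (x + t *\<^sub>R u) - f (x + t *\<^sub>R v)\<bar> \<le> L * (t * norm (u - v))"
        using lipschitz_bound[of "x + t *\<^sub>R u" "x + t *\<^sub>R v"] \<open>t > 0\<close>
        by (simp flip: scaleR_diff_right)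
      also have "\<dots> \<le> L * (t * \<eta>)"
        using L \<open>t > 0\<close> v by (intro mult_left_mono) auto
      finally have 1: "\<bar>f (x + t *\<^sub>R u) - f (x + t *\<^sub>R v)\<bar> \<le> L * (t * \<eta>)" .
      have 2: "\<bar>f (x + t *\<^sub>R v) - f x - t * T v\<bar> \<le> \<eta> * t"
        using d(2)[OF \<open>v \<in> F\<close>, of t] \<delta>[OF \<open>v \<in> F\<close>] y \<open>t > 0\<close> by (simp add: t_def)
      have "\<bar>T (u - v)\<bar> \<le> \<eta> * C"
        using C[of "u - v"] v \<open>C > 0\<close> by (smt (verit) mult_right_mono real_norm_def)
      then have "\<bar>t * T (u - v)\<bar> \<le> t * (\<eta> * C)"
        using \<open>t > 0\<close> by (simp add: abs_mult)
      then have 3: "\<bar>t * T u - t * T v\<bar> \<le> t * (\<eta> * C)"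
        by (simp add: T.diff right_diff_distrib)
      have "\<bar>f y - f x - t * T u\<bar> \<le> L * (t * \<eta>) + \<eta> * t + t * (\<eta> * C)"
        using 1 2 3 unfolding yx by linarith
      also have "\<dots> = (L + 1 + C) * \<eta> * t" by (simp add: algebra_simps)
      also have "(L + 1 + C) * \<eta> = e" using L \<open>C > 0\<close> by (simp add: \<eta>_def)
      also have "t * T u = T (y - x)" using yx by (simp add: T.scaleR)
      finally show ?thesis by (simp add: t_def)
    qed (simp add: T.zero)
  qed
qed

theorem Rademacher: "AE x in lebesgue. f differentiable at x"
proof -
  obtain D :: "'a set" where "countable D"
    and dense: "\<And>X. open X \<Longrightarrow> X \<noteq> {} \<Longrightarrow> \<exists>d\<in>D. d \<in> X"
    using countable_dense_exists by metis
  define T where "T x v = (\<Sum>b\<in>Basis. (v \<bullet> b) * dirderiv f b x)" for x v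
  have bl: "bounded_linear (T x)" for x
    unfolding T_def[abs_def]
    by (intro bounded_linear_sum bounded_linear_mult_left[THEN bounded_linear_compose]
        bounded_linear_inner_left)
  have "AE x in lborel. \<forall>v\<in>D. ((\<lambda>t. f (x + t *\<^sub>R v)) has_real_derivative T x v) (at 0)"
    unfolding AE_ball_countable[OF \<open>countable D\<close>]
  proof
    fix v
    show "AE x in lborel. ((\<lambda>t. f (x + t *\<^sub>R v)) has_real_derivative T x v) (at 0)"
      using lipschitz_directionally_differentiable_AE[of v] dirderiv_linear_AE[of v]
      by eventually_elim (simp add: T_def)
  qed
  then have "AE x in lborel. f differentiable at x"
  proof eventually_elim
    case (elim x)
    have "(f has_derivative T x) (at x)"
      by (rule differentiable_if_dense_directions[OF dense bl]) (use elim in auto)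
    then show ?case by (auto simp: differentiable_def)
  qed
  then show ?thesis by (simp add: AE_completion)
qed

end

section \<open>The gauge of a starlike surface\<close>

text \<open>A compact set meeting each open ray from the origin in exactly one point: the property of the
  boundary of a strictly starlike domain on which everything below rests.\<close>

definition star_surface :: "'a::euclidean_space set \<Rightarrow> bool" where
  "star_surface M \<longleftrightarrow> compact M \<and> 0 \<notin> M \<and> (\<forall>x. x \<noteq> 0 \<longrightarrow> (\<exists>!t. 0 < t \<and> t *\<^sub>R x \<in> M))"

lemma strictly_starlike_imp_star_surface:
  assumes "strictly_starlike 0 D"
  shows "star_surface (frontier D)"
  unfolding star_surface_def
proof (intro conjI allI impI)
  have D: "open D" "bounded D" "0 \<in> D" and
    ray: "\<And>u. norm u = 1 \<Longrightarrow> \<exists>!w. w \<in> {t *\<^sub>R u |t. 0 \<le> t} \<inter> frontier D"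
    using assms by (auto simp: strictly_starlike_def)
  show "compact (frontier D)" using D by (simp add: compact_frontier_bounded)
  show 0: "0 \<notin> frontier D" using D by (simp add: frontier_def interior_open)
  fix x :: 'a assume "x \<noteq> 0"
  obtain w where w: "w \<in> {t *\<^sub>R sgn x |t. 0 \<le> t}" "w \<in> frontier D"
    and uniq: "\<And>v. v \<in> {t *\<^sub>R sgn x |t. 0 \<le> t} \<Longrightarrow> v \<in> frontier D \<Longrightarrow> v = w"
    using ray[of "sgn x"] \<open>x \<noteq> 0\<close> by (auto simp: norm_sgn)
  obtain t where t: "w = t *\<^sub>R sgn x" "0 \<le> t" using w by auto
  with 0 w have "t > 0" by (metis less_eq_real_def scaleR_zero_left)
  have *: "s *\<^sub>R x = (s * norm x) *\<^sub>R sgn x" for s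
    using \<open>x \<noteq> 0\<close> by (simp add: sgn_div_norm)
  show "\<exists>!t. 0 < t \<and> t *\<^sub>R x \<in> frontier D"
  proof (rule ex1I[of _ "t / norm x"])
    show "0 < t / norm x \<and> (t / norm x) *\<^sub>R x \<in> frontier D"
      using \<open>t > 0\<close> \<open>x \<noteq> 0\<close> w t by (simp add: sgn_div_norm divide_inverse)
    fix s assume s: "0 < s \<and> s *\<^sub>R x \<in> frontier D"
    then have "s *\<^sub>R x = w"
      by (intro uniq) (auto simp: * intro!: exI[of _ "s * norm x"])
    then have "(s * norm x - t) *\<^sub>R sgn x = 0"
      using * t by (simp add: scaleR_diff_left)
    then show "s = t / norm x"
      using \<open>x \<noteq> 0\<close> by (simp add: field_simps sgn_zero_iff)
  qed
qed

text \<open>The positively homogeneous function equal to \<open>1\<close> on \<open>M\<close>, that is \<open>\<bar>x\<bar> / r\<^sub>x\<close> where \<open>r\<^sub>x\<close> is the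
  distance from the origin to \<open>M\<close> on the ray through \<open>x\<close>. At the origin the numerator makes it \<open>0\<close>.\<close>

definition star_gauge :: "'a::euclidean_space set \<Rightarrow> 'a \<Rightarrow> real" where
  "star_gauge M x = norm x / norm (radial_point M x)"

text \<open>The component of \<open>h\<close> orthogonal to \<open>x\<close>.\<close>

definition tangential :: "'a::euclidean_space \<Rightarrow> 'a \<Rightarrow> 'a" where
  "tangential x h = h - ((h \<bullet> x) / (x \<bullet> x)) *\<^sub>R x"

lemma tangential_inner: "x \<noteq> 0 \<Longrightarrow> tangential x h \<bullet> x = 0"
  by (simp add: tangential_def inner_diff_left)

lemma tangential_decomp: "h = ((h \<bullet> x) / (x \<bullet> x)) *\<^sub>R x + tangential x h"
  by (simp add: tangential_def)

lemma tangential_scaleR: "tangential x (c *\<^sub>R h) = c *\<^sub>R tangential x h"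
  by (simp add: tangential_def scaleR_diff_right)

lemma tangential_scaleR_left: "c \<noteq> 0 \<Longrightarrow> tangential (c *\<^sub>R x) h = tangential x h"
  by (simp add: tangential_def)

lemma norm_tangential_le: "norm (tangential x h) \<le> norm h"
proof (cases "x = 0")
  case False
  have "norm h ^ 2 = norm (((h \<bullet> x) / (x \<bullet> x)) *\<^sub>R x + tangential x h) ^ 2"
    using tangential_decomp[of h x] by simp
  also have "\<dots> = norm (((h \<bullet> x) / (x \<bullet> x)) *\<^sub>R x) ^ 2 + norm (tangential x h) ^ 2"
    by (rule norm_add_Pythagorean)
      (use tangential_inner[OF False, of h] in \<open>simp add: orthogonal_def inner_commute\<close>)
  finally have "norm (tangential x h) ^ 2 \<le> norm h ^ 2" by simp
  then show ?thesis by (rule power2_le_imp_le) simp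
qed (simp add: tangential_def)

text \<open>A pointwise Lipschitz bound with the same constant at all points propagates along segments.\<close>

lemma lipschitz_if_pointwise_lipschitz:
  fixes f :: "'a::real_normed_vector \<Rightarrow> 'b::real_normed_vector"
  assumes "0 \<le> L"
    and loc: "\<And>x. \<forall>\<^sub>F y in nhds x. norm (f y - f x) \<le> L * norm (y - x)"
  shows "L-lipschitz_on UNIV f"
proof (rule lipschitz_onI[OF _ \<open>0 \<le> L\<close>])
  fix x y :: 'a
  define g where "g t = x + t *\<^sub>R (y - x)" for t :: real
  have g: "norm (g t - g s) = \<bar>t - s\<bar> * norm (y - x)" for s t
  proof -
    have "g t - g s = (t - s) *\<^sub>R (y - x)" by (simp add: g_def algebra_simps)
    then show ?thesis by simp
  qed
  define P where "P a b \<longleftrightarrow> norm (f (g b) - f (g a)) \<le> L * (b - a) * norm (y - x)" for a b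
  have "P 0 1"
  proof (rule Bolzano)
    fix a b c assume "P a b" "P b c" "a \<le> b" "b \<le> c"
    then show "P a c"
      using norm_triangle_ineq[of "f (g c) - f (g b)" "f (g b) - f (g a)"]
      by (simp add: P_def algebra_simps)
  next
    fix t :: real
    have "\<forall>\<^sub>F s in nhds t. norm (f (g s) - f (g t)) \<le> L * norm (g s - g t)"
    proof (rule eventually_compose_filterlim[OF loc])
      have "isCont g t" unfolding g_def[abs_def] by (intro continuous_intros)
      then show "filterlim g (nhds (g t)) (nhds t)"
        using tendsto_at_iff_tendsto_nhds isContD by blast
    qed
    then obtain d where "d > 0"
      and d: "\<And>s. \<bar>s - t\<bar> < d \<Longrightarrow> norm (f (g s) - f (g t)) \<le> L * (\<bar>s - t\<bar> * norm (y - x))"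
      unfolding eventually_nhds_metric g by (auto simp: dist_real_def)
    show "\<exists>d>0. \<forall>a b. a \<le> t \<and> t \<le> b \<and> b - a < d \<longrightarrow> P a b"
    proof (intro exI[of _ d] conjI allI impI \<open>d > 0\<close>)
      fix a b assume ab: "a \<le> t \<and> t \<le> b \<and> b - a < d"
      have "norm (f (g b) - f (g a)) \<le> norm (f (g b) - f (g t)) + norm (f (g a) - f (g t))"
        using norm_triangle_ineq4[of "f (g b) - f (g t)" "f (g a) - f (g t)"] by simp
      also have "\<dots> \<le> L * ((b - t) * norm (y - x)) + L * ((t - a) * norm (y - x))"
        using d[of a] d[of b] ab by (intro add_mono) auto
      finally show "P a b" by (simp add: P_def algebra_simps)
    qed
  qed simp
  then show "dist (f x) (f y) \<le> L * dist x y"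
    by (simp add: P_def g_def dist_norm norm_minus_commute)
qed

context
  fixes M :: "'a::euclidean_space set"
  assumes M: "star_surface M"
begin

lemma radial_point_eqI:
  assumes "0 < t" "t *\<^sub>R x \<in> M"
  shows "radial_point M x = t *\<^sub>R x"
  unfolding radial_point_def
proof (rule the_equality)
  show "t *\<^sub>R x \<in> {t *\<^sub>R x |t. 0 < t} \<inter> M" using assms by auto
  fix w assume w: "w \<in> {t *\<^sub>R x |t. 0 < t} \<inter> M"
  have "x \<noteq> 0" using M assms by (auto simp: star_surface_def)
  then show "w = t *\<^sub>R x" using w assms M unfolding star_surface_def by blast
qed

lemma radial_point_obtain:
  assumes "x \<noteq> 0"
  obtains t where "0 < t" "t *\<^sub>R x \<in> M" "radial_point M x = t *\<^sub>R x"
  using M assms radial_point_eqI unfolding star_surface_def by metis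

lemma star_gauge_eqI:
  assumes "0 < t" "t *\<^sub>R x \<in> M"
  shows "star_gauge M x = 1 / t"
proof -
  have "x \<noteq> 0" using M assms by (auto simp: star_surface_def)
  then show ?thesis using radial_point_eqI[OF assms] assms by (simp add: star_gauge_def)
qed

lemma star_gauge_zero [simp]: "star_gauge M 0 = 0"
  by (simp add: star_gauge_def)

lemma star_gauge_pos: "x \<noteq> 0 \<Longrightarrow> 0 < star_gauge M x"
  by (metis radial_point_obtain star_gauge_eqI zero_less_divide_1_iff)

lemma star_gauge_nonneg: "0 \<le> star_gauge M x"
  by (simp add: star_gauge_def)

lemma radial_point_eq: "x \<noteq> 0 \<Longrightarrow> radial_point M x = x /\<^sub>R star_gauge M x"
  by (metis radial_point_obtain star_gauge_eqI inverse_eq_divide inverse_inverse_eq)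

lemma divide_star_gauge_in: "x \<noteq> 0 \<Longrightarrow> x /\<^sub>R star_gauge M x \<in> M"
  by (metis radial_point_obtain radial_point_eq)

lemma star_gauge_on_surface: "x \<in> M \<Longrightarrow> star_gauge M x = 1"
  using star_gauge_eqI[of 1 x] by simp

lemma star_gauge_scaleR:
  assumes "0 < c"
  shows "star_gauge M (c *\<^sub>R x) = c * star_gauge M x"
proof (cases "x = 0")
  case False
  obtain t where t: "0 < t" "t *\<^sub>R x \<in> M" using radial_point_obtain[OF False] by metis
  then have "star_gauge M (c *\<^sub>R x) = 1 / (t / c)"
    using assms by (intro star_gauge_eqI) auto
  then show ?thesis using star_gauge_eqI[OF t] by simp
qed simp

lemma star_gauge_bounds:
  obtains m R where "0 < m" "0 < R"
    "\<And>x. norm x / R \<le> star_gauge M x" "\<And>x. star_gauge M x \<le> norm x / m"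
proof -
  have "compact M" "0 \<notin> M" using M by (auto simp: star_surface_def)
  then obtain m where m: "m > 0" "ball 0 m \<subseteq> - M"
    using openE[of "- M" 0] compact_imp_closed by (metis ComplI open_Compl)
  obtain R where R: "R > 0" "\<And>w. w \<in> M \<Longrightarrow> norm w \<le> R"
    using compact_imp_bounded[OF \<open>compact M\<close>] bounded_pos by metis
  have "norm x / R \<le> star_gauge M x \<and> star_gauge M x \<le> norm x / m" for x
  proof (cases "x = 0")
    case False
    have "radial_point M x \<in> M" using False by (simp add: radial_point_eq divide_star_gauge_in)
    then have "norm (radial_point M x) \<le> R" "m \<le> norm (radial_point M x)" using m R by force+
    then show ?thesis
      unfolding star_gauge_def using m(1) by (auto intro!: divide_left_mono mult_pos_pos)
  qed simp
  then show thesis using that m(1) R(1) by blast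
qed

text \<open>The radial projection of the compact set \<open>M\<close> to the unit sphere is injective and continuous,
  hence has a continuous inverse.\<close>

lemma isCont_star_gauge:
  assumes "x \<noteq> 0"
  shows "isCont (star_gauge M) x"
proof -
  have "compact M" "0 \<notin> M" using M by (auto simp: star_surface_def)
  have "continuous_on (sgn ` M) (radial_point M)"
  proof (rule continuous_on_inv[OF _ \<open>compact M\<close>])
    show "continuous_on M sgn"
      unfolding sgn_div_norm[abs_def] using \<open>0 \<notin> M\<close> by (auto intro!: continuous_intros)
    show "\<forall>x\<in>M. radial_point M (sgn x) = x"
    proof
      fix x assume "x \<in> M"
      then have "x \<noteq> 0" using \<open>0 \<notin> M\<close> by auto
      then show "radial_point M (sgn x) = x"
        using radial_point_eqI[of "norm x" "sgn x"] \<open>x \<in> M\<close> by (simp add: sgn_div_norm)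
    qed
  qed
  moreover have "sgn ` (- {0}) \<subseteq> sgn ` M"
  proof (rule image_subsetI)
    fix x :: 'a assume "x \<in> - {0}"
    then have "x \<noteq> 0" by simp
    then have "sgn x = sgn (x /\<^sub>R star_gauge M x)"
      using star_gauge_pos[of x] by (simp add: sgn_scaleR)
    then show "sgn x \<in> sgn ` M" using divide_star_gauge_in[OF \<open>x \<noteq> 0\<close>] by blast
  qed
  ultimately have "continuous_on (sgn ` (- {0})) (radial_point M)"
    by (rule continuous_on_subset)
  then have "continuous_on (- {0}) (\<lambda>x. radial_point M (sgn x))"
    by (rule continuous_on_compose2[where g = "radial_point M"])
      (auto simp: sgn_div_norm intro!: continuous_intros)
  moreover have *: "star_gauge M x = norm x / norm (radial_point M (sgn x))" if "x \<noteq> 0" for x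
    using star_gauge_scaleR[of "norm x" "sgn x"] that
    by (simp add: star_gauge_def norm_sgn sgn_div_norm)
  moreover have "radial_point M (sgn x) \<noteq> 0" if "x \<noteq> 0" for x
    using radial_point_eq[of "sgn x"] star_gauge_pos[of "sgn x"] that by (simp add: sgn_zero_iff)
  ultimately have "continuous_on (- {0}) (\<lambda>x. norm x / norm (radial_point M (sgn x)))"
    by (intro continuous_on_divide continuous_on_norm continuous_on_id) simp_all
  then have "continuous_on (- {0}) (star_gauge M)"
    by (rule continuous_on_eq) (simp add: *)
  then show ?thesis
    using assms by (simp add: continuous_on_eq_continuous_at open_delete open_Compl)
qed

text \<open>An angle condition at the point \<open>x\<close> of the surface, read as an estimate for the gauge. Write
  \<open>z - x = a *\<^sub>R x + w\<close> with \<open>w\<close> orthogonal to \<open>x\<close>. The hypothesis says \<open>\<bar>a\<bar> \<bar>x\<bar> \<le> \<kappa> \<bar>w\<bar>\<close>. With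
  \<open>s = star_gauge M y\<close> the left hand side is \<open>s \<bar>a\<bar> \<bar>x\<bar>\<^sup>2\<close> and \<open>s *\<^sub>R w\<close> is the tangential part of
  \<open>y - x\<close>.\<close>

lemma star_gauge_tangential_aux:
  assumes "x \<noteq> 0" "star_gauge M x = 1" "y \<noteq> 0" "0 \<le> \<kappa>"
    and z: "z = y /\<^sub>R star_gauge M y"
    and le: "\<bar>(z - x) \<bullet> x\<bar> \<le> \<kappa> / sqrt (1 + \<kappa>\<^sup>2) * (norm (z - x) * norm x)"
  shows "\<bar>(star_gauge M y - 1) * (norm x)\<^sup>2 - (y - x) \<bullet> x\<bar> \<le> \<kappa> * norm x * norm (tangential x (y - x))"
proof -
  define s where "s = star_gauge M y"
  have "s > 0" unfolding s_def by (rule star_gauge_pos) fact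
  define w where "w = tangential x (z - x)"
  define a where "a = ((z - x) \<bullet> x) / (x \<bullet> x)"
  have y: "y = s *\<^sub>R z" using \<open>s > 0\<close> by (simp add: z s_def)
  have zx: "z - x = a *\<^sub>R x + w" unfolding a_def w_def by (rule tangential_decomp)
  have wx: "w \<bullet> x = 0" unfolding w_def by (rule tangential_inner) fact
  have ax: "(z - x) \<bullet> x = a * (norm x)\<^sup>2" by (simp add: zx inner_add_left wx power2_norm_eq_inner)
  have yx: "y - x = (s - 1 + s * a) *\<^sub>R x + s *\<^sub>R w"
  proof -
    have "y - x = s *\<^sub>R (z - x) + (s - 1) *\<^sub>R x" by (simp add: y algebra_simps)
    then show ?thesis by (simp add: zx algebra_simps)
  qed
  then have tang: "tangential x (y - x) = s *\<^sub>R w"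
    using \<open>x \<noteq> 0\<close> by (simp add: tangential_def inner_add_left wx)
  have inn: "(y - x) \<bullet> x = (s - 1 + s * a) * (norm x)\<^sup>2"
    by (simp add: yx inner_add_left wx power2_norm_eq_inner)
  have pyth: "(norm (z - x))\<^sup>2 = a\<^sup>2 * (norm x)\<^sup>2 + (norm w)\<^sup>2"
    unfolding zx by (subst norm_add_Pythagorean) (simp_all add: orthogonal_def wx inner_commute power_mult_distrib)
  have "\<bar>a\<bar> * norm x \<le> \<kappa> * norm w"
  proof -
    have "(\<bar>a\<bar> * norm x) * norm x \<le> (\<kappa> / sqrt (1 + \<kappa>\<^sup>2) * norm (z - x)) * norm x"
      using le by (simp add: ax abs_mult power2_eq_square mult_ac)
    then have "\<bar>a\<bar> * norm x \<le> \<kappa> / sqrt (1 + \<kappa>\<^sup>2) * norm (z - x)"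
      by (rule mult_right_le_imp_le) (use \<open>x \<noteq> 0\<close> in simp)
    then have "(\<bar>a\<bar> * norm x)\<^sup>2 \<le> (\<kappa> / sqrt (1 + \<kappa>\<^sup>2) * norm (z - x))\<^sup>2"
      by (rule power_mono) simp
    also have "\<dots> = \<kappa>\<^sup>2 / (1 + \<kappa>\<^sup>2) * (a\<^sup>2 * (norm x)\<^sup>2 + (norm w)\<^sup>2)"
      by (simp add: power_mult_distrib power_divide pyth add_nonneg_nonneg)
    finally have "a\<^sup>2 * (norm x)\<^sup>2 * (1 + \<kappa>\<^sup>2) \<le> \<kappa>\<^sup>2 * (a\<^sup>2 * (norm x)\<^sup>2 + (norm w)\<^sup>2)"
      by (simp add: power_mult_distrib field_simps add_pos_nonneg)
    then have "(\<bar>a\<bar> * norm x)\<^sup>2 \<le> (\<kappa> * norm w)\<^sup>2"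
      by (simp add: power_mult_distrib algebra_simps)
    then show ?thesis by (rule power2_le_imp_le) (use \<open>0 \<le> \<kappa>\<close> in simp)
  qed
  then have "s * norm x * (\<bar>a\<bar> * norm x) \<le> s * norm x * (\<kappa> * norm w)"
    using \<open>s > 0\<close> by (intro mult_left_mono) auto
  moreover have "(s - 1) * (norm x)\<^sup>2 - (y - x) \<bullet> x = - (s * a * (norm x)\<^sup>2)"
    unfolding inn by (simp add: algebra_simps)
  ultimately show ?thesis
    unfolding s_def[symmetric] tang using \<open>s > 0\<close>
    by (simp add: abs_mult power2_eq_square mult_ac)
qed

text \<open>The number \<open>\<kappa> / sqrt (1 + \<kappa>\<^sup>2)\<close> is the cosine of the angle with cotangent \<open>\<kappa>\<close>; that angle is
  smaller than \<open>\<alpha>\<close>, so near \<open>x\<close> all chords make a larger angle with the ray.\<close>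

lemma tangent_condition_eventually:
  assumes \<alpha>: "0 < \<alpha>" "\<alpha> \<le> pi / 2" "tangent_condition \<alpha> M"
    and \<kappa>: "cot \<alpha> < \<kappa>" and "x \<in> M"
  shows "\<forall>\<^sub>F z in nhds x. z \<in> M \<longrightarrow> \<bar>(z - x) \<bullet> x\<bar> \<le> \<kappa> / sqrt (1 + \<kappa>\<^sup>2) * (norm (z - x) * norm x)"
proof -
  define c where "c = \<kappa> / sqrt (1 + \<kappa>\<^sup>2)"
  have sin: "sin \<alpha> > 0" using \<alpha> by (intro sin_gt_zero) (auto simp: pi_gt_zero)
  have cos: "cos \<alpha> \<ge> 0" using \<alpha> by (intro cos_ge_zero) auto
  have "\<kappa> > 0" using \<kappa> sin cos by (smt (verit) cot_def divide_nonneg_pos)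
  have "cos \<alpha> < c"
  proof -
    have "cos \<alpha> < \<kappa> * sin \<alpha>" using \<kappa> sin by (simp add: cot_def divide_less_eq)
    then have "(cos \<alpha>)\<^sup>2 < (\<kappa> * sin \<alpha>)\<^sup>2" using cos by (intro power_strict_mono) auto
    then have "(cos \<alpha>)\<^sup>2 * (1 + \<kappa>\<^sup>2) < \<kappa>\<^sup>2"
      by (simp add: power_mult_distrib sin_squared_eq algebra_simps)
    then have "(cos \<alpha>)\<^sup>2 < \<kappa>\<^sup>2 / (1 + \<kappa>\<^sup>2)" by (simp add: field_simps add_pos_nonneg)
    also have "\<dots> = c\<^sup>2" by (simp add: c_def power_divide add_nonneg_nonneg)
    finally show ?thesis by (rule power2_less_imp_less) (use \<open>\<kappa> > 0\<close> in \<open>simp add: c_def\<close>)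
  qed
  have "\<kappa> < sqrt (1 + \<kappa>\<^sup>2)"
    by (rule real_less_rsqrt) simp
  moreover from this \<open>\<kappa> > 0\<close> have "0 < sqrt (1 + \<kappa>\<^sup>2)" by linarith
  ultimately have c: "0 \<le> c" "c < 1"
    using \<open>\<kappa> > 0\<close> unfolding c_def by (simp_all only: divide_less_eq_1_pos zero_le_divide_iff) auto
  have "arccos c < \<alpha>"
  proof -
    have "arccos c < arccos (cos \<alpha>)" using \<open>cos \<alpha> < c\<close> cos c by (intro arccos_less_arccos) auto
    then show ?thesis using \<alpha> by (simp add: arccos_cos)
  qed
  moreover have "ereal \<alpha> \<le> Liminf (at x within M) (\<lambda>z. ereal (tangent_angle z x))"
    using \<alpha>(3) \<open>x \<in> M\<close> by (auto simp: tangent_condition_def)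
  ultimately have "\<forall>\<^sub>F z in at x within M. arccos c < tangent_angle z x"
    unfolding le_Liminf_iff by (auto dest: spec[of _ "ereal (arccos c)"])
  then have "\<forall>\<^sub>F z in nhds x. z \<in> M \<longrightarrow> z \<noteq> x \<longrightarrow> arccos c < tangent_angle z x"
    unfolding eventually_at_filter by (rule eventually_mono) auto
  then show ?thesis
    unfolding c_def[symmetric]
  proof eventually_elim
    case (elim z)
    show ?case
    proof (cases "z = x")
      case False
      show ?thesis
      proof
        assume "z \<in> M"
        have "x \<noteq> 0" using M \<open>x \<in> M\<close> by (auto simp: star_surface_def)
        define w where "w = \<bar>(z - x) \<bullet> x\<bar> / (norm (z - x) * norm x)"
        have "w \<le> 1"
          unfolding w_def using Cauchy_Schwarz_ineq2[of "z - x" x] False \<open>x \<noteq> 0\<close>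
          by (subst divide_le_eq_1_pos) auto
        have "w \<ge> 0" by (simp add: w_def)
        have "arccos c < arccos w"
          using elim \<open>z \<in> M\<close> False by (simp add: tangent_angle_def w_def)
        then have "w < c"
          using arccos_le_arccos[of c w] c \<open>w \<le> 1\<close> by (meson dual_order.trans linorder_not_less neg_le_0_iff_le zero_le_one)
        then show "\<bar>(z - x) \<bullet> x\<bar> \<le> c * (norm (z - x) * norm x)"
          using False \<open>x \<noteq> 0\<close> by (simp add: w_def divide_less_eq less_imp_le)
      qed
    qed simp
  qed
qed

text \<open>For \<open>h = y - x\<close> this says: up to the radial part \<open>star_gauge M x * (h \<bullet> x) / \<bar>x\<bar>\<^sup>2\<close> prescribed by
  homogeneity, the gauge has logarithmic slope at most \<open>\<kappa> / \<bar>x\<bar>\<close> in tangential directions.\<close>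

lemma star_gauge_tangential:
  assumes \<alpha>: "0 < \<alpha>" "\<alpha> \<le> pi / 2" "tangent_condition \<alpha> M"
    and \<kappa>: "cot \<alpha> < \<kappa>" and "x \<noteq> 0"
  shows "\<forall>\<^sub>F y in nhds x. \<bar>(star_gauge M y - star_gauge M x) * (norm x)\<^sup>2 - star_gauge M x * ((y - x) \<bullet> x)\<bar>
    \<le> \<kappa> * star_gauge M x * norm x * norm (tangential x (y - x))"
proof -
  have "cot \<alpha> \<ge> 0" using \<alpha> by (auto simp: cot_def intro!: divide_nonneg_nonneg cos_ge_zero sin_ge_zero)
  then have "\<kappa> \<ge> 0" using \<kappa> by simp
  define r where "r = star_gauge M x"
  have "r > 0" using star_gauge_pos[OF \<open>x \<noteq> 0\<close>] by (simp add: r_def)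
  define x0 where "x0 = x /\<^sub>R r"
  have "x0 \<in> M" using divide_star_gauge_in[OF \<open>x \<noteq> 0\<close>] by (simp add: x0_def r_def)
  have "x0 \<noteq> 0" using \<open>x \<noteq> 0\<close> \<open>r > 0\<close> by (simp add: x0_def)
  have g0: "star_gauge M x0 = 1" using star_gauge_on_surface \<open>x0 \<in> M\<close> by blast
  have x: "x = r *\<^sub>R x0" using \<open>r > 0\<close> by (simp add: x0_def)
  have "((\<lambda>y. y /\<^sub>R star_gauge M y) \<longlongrightarrow> x0) (nhds x)"
  proof -
    have "isCont (\<lambda>y. y /\<^sub>R star_gauge M y) x"
      using star_gauge_pos[OF \<open>x \<noteq> 0\<close>]
      by (intro continuous_intros isCont_star_gauge \<open>x \<noteq> 0\<close>) auto
    then show ?thesis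
      using tendsto_at_iff_tendsto_nhds[of "\<lambda>y. y /\<^sub>R star_gauge M y" x]
      by (simp add: x0_def r_def isCont_def)
  qed
  from eventually_compose_filterlim[OF tangent_condition_eventually[OF \<alpha> \<kappa> \<open>x0 \<in> M\<close>] this]
  have "\<forall>\<^sub>F y in nhds x. y /\<^sub>R star_gauge M y \<in> M \<longrightarrow>
      \<bar>(y /\<^sub>R star_gauge M y - x0) \<bullet> x0\<bar> \<le> \<kappa> / sqrt (1 + \<kappa>\<^sup>2) * (norm (y /\<^sub>R star_gauge M y - x0) * norm x0)" .
  moreover have "\<forall>\<^sub>F y in nhds x. y \<noteq> 0"
    using \<open>x \<noteq> 0\<close> by (intro t1_space_nhds)
  ultimately show ?thesis
  proof eventually_elim
    case (elim y)
    define y0 where "y0 = y /\<^sub>R r"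
    have y: "y = r *\<^sub>R y0" using \<open>r > 0\<close> by (simp add: y0_def)
    have "y0 \<noteq> 0" using elim \<open>r > 0\<close> by (simp add: y0_def)
    have gy: "star_gauge M y = r * star_gauge M y0" by (simp add: y star_gauge_scaleR[OF \<open>r > 0\<close>])
    have "\<bar>(star_gauge M y0 - 1) * (norm x0)\<^sup>2 - (y0 - x0) \<bullet> x0\<bar> \<le> \<kappa> * norm x0 * norm (tangential x0 (y0 - x0))"
    proof (rule star_gauge_tangential_aux[OF \<open>x0 \<noteq> 0\<close> g0 \<open>y0 \<noteq> 0\<close> \<open>\<kappa> \<ge> 0\<close> refl])
      have eq: "y0 /\<^sub>R star_gauge M y0 = y /\<^sub>R star_gauge M y"
        unfolding gy by (simp add: y0_def)
      show "\<bar>(y0 /\<^sub>R star_gauge M y0 - x0) \<bullet> x0\<bar>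
          \<le> \<kappa> / sqrt (1 + \<kappa>\<^sup>2) * (norm (y0 /\<^sub>R star_gauge M y0 - x0) * norm x0)"
        unfolding eq using elim divide_star_gauge_in by blast
    qed
    \<comment> \<open>Both sides are homogeneous of degree 3 in the pair \<open>(x, y)\<close>.\<close>
    then have "r ^ 3 * \<bar>(star_gauge M y0 - 1) * (norm x0)\<^sup>2 - (y0 - x0) \<bullet> x0\<bar>
        \<le> r ^ 3 * (\<kappa> * norm x0 * norm (tangential x0 (y0 - x0)))"
      using \<open>r > 0\<close> by (intro mult_left_mono) auto
    moreover have "(star_gauge M y - r) * (norm x)\<^sup>2 - r * ((y - x) \<bullet> x)
        = r ^ 3 * ((star_gauge M y0 - 1) * (norm x0)\<^sup>2 - (y0 - x0) \<bullet> x0)"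
      unfolding gy using \<open>r > 0\<close>
      by (simp add: x y power_mult_distrib power2_eq_square power3_eq_cube algebra_simps)
    moreover have "tangential x (y - x) = r *\<^sub>R tangential x0 (y0 - x0)"
      using \<open>r > 0\<close> unfolding x y
      by (simp add: tangential_scaleR_left flip: scaleR_diff_right tangential_scaleR)
    moreover have "\<kappa> * r * norm x * norm (r *\<^sub>R tangential x0 (y0 - x0))
        = r ^ 3 * (\<kappa> * norm x0 * norm (tangential x0 (y0 - x0)))"
      using \<open>r > 0\<close> by (simp add: x power3_eq_cube)
    moreover have "\<bar>r ^ 3 * c\<bar> = r ^ 3 * \<bar>c\<bar>" for c
      using \<open>r > 0\<close> by (simp add: abs_mult)
    ultimately show ?case
      unfolding r_def[symmetric] by (simp only:)
  qed
qed

lemma star_gauge_lipschitz: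
  assumes \<alpha>: "0 < \<alpha>" "\<alpha> \<le> pi / 2" "tangent_condition \<alpha> M"
  obtains L where "L-lipschitz_on UNIV (star_gauge M)"
proof -
  obtain m where m: "0 < m" "\<And>x. star_gauge M x \<le> norm x / m"
    using star_gauge_bounds by metis
  have "cot \<alpha> \<ge> 0" using \<alpha> by (auto simp: cot_def intro!: divide_nonneg_nonneg cos_ge_zero sin_ge_zero)
  \<comment> \<open>The tangential estimate holds for every constant above \<open>cot \<alpha>\<close>; the radial part of the
    increment contributes the summand \<open>1\<close> in \<open>L\<close>, and \<open>star_gauge M x / \<bar>x\<bar> \<le> 1 / m\<close>.\<close>
  define \<kappa> where "\<kappa> = cot \<alpha> + 1"
  have \<kappa>: "cot \<alpha> < \<kappa>" "\<kappa> > 0" using \<open>cot \<alpha> \<ge> 0\<close> by (auto simp: \<kappa>_def)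
  define L where "L = (1 + \<kappa>) / m"
  have "L-lipschitz_on UNIV (star_gauge M)"
  proof (rule lipschitz_if_pointwise_lipschitz)
    show "0 \<le> L" using m \<kappa> by (simp add: L_def)
    fix x
    show "\<forall>\<^sub>F y in nhds x. norm (star_gauge M y - star_gauge M x) \<le> L * norm (y - x)"
    proof (cases "x = 0")
      case True
      have "star_gauge M y \<le> L * norm y" for y
        using m(2)[of y] m(1) \<kappa>(2) by (simp add: L_def field_simps) (smt (verit) mult_nonneg_nonneg norm_ge_zero)
      then show ?thesis using True star_gauge_nonneg by simp
    next
      case False
      from star_gauge_tangential[OF \<alpha> \<kappa>(1) False] show ?thesis
      proof eventually_elim
        case (elim y)
        let ?N = "star_gauge M"
        have N: "?N x \<ge> 0" by (rule star_gauge_nonneg)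
        have "\<bar>?N x * ((y - x) \<bullet> x)\<bar> \<le> ?N x * (norm (y - x) * norm x)"
          using Cauchy_Schwarz_ineq2[of "y - x" x] N by (simp add: abs_mult mult_left_mono)
        moreover have "\<kappa> * ?N x * norm x * norm (tangential x (y - x)) \<le> \<kappa> * ?N x * norm x * norm (y - x)"
          using \<kappa> N by (intro mult_left_mono norm_tangential_le) auto
        ultimately have "\<bar>(?N y - ?N x) * (norm x)\<^sup>2\<bar> \<le> (1 + \<kappa>) * ?N x * norm x * norm (y - x)"
          using elim by (simp add: algebra_simps)
        also have "\<dots> \<le> (1 + \<kappa>) * (norm x / m) * norm x * norm (y - x)"
          using \<kappa> m(2)[of x] by (intro mult_right_mono mult_left_mono) auto
        also have "\<dots> = (L * norm (y - x)) * (norm x)\<^sup>2"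
          by (simp add: L_def power2_eq_square)
        finally show ?case
          using False by (simp add: abs_mult)
      qed
    qed
  qed
  then show thesis by (rule that)
qed

text \<open>Euler's identity for homogeneous functions.\<close>

lemma star_gauge_derivative_radial:
  assumes "x \<noteq> 0" "(star_gauge M has_derivative N') (at x)"
  shows "N' x = star_gauge M x"
proof -
  interpret bounded_linear N' using assms(2) by (rule has_derivative_bounded_linear)
  have "((\<lambda>t. star_gauge M (x + t *\<^sub>R x)) has_derivative (\<lambda>t. N' (t *\<^sub>R x))) (at (0::real))"
    by (rule has_derivative_compose[where g = "star_gauge M"])
      (use assms(2) in \<open>auto intro!: derivative_eq_intros\<close>)
  then have "((\<lambda>t. star_gauge M (x + t *\<^sub>R x)) has_real_derivative N' x) (at 0)"
    by (simp add: has_field_derivative_def scaleR mult_commute_abs)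
  moreover have "((\<lambda>t. star_gauge M (x + t *\<^sub>R x)) has_real_derivative star_gauge M x) (at 0)"
  proof (rule DERIV_cong_ev[THEN iffD1, rotated 3])
    show "((\<lambda>t. (1 + t) * star_gauge M x) has_real_derivative star_gauge M x) (at 0)"
      by (auto intro!: derivative_eq_intros)
    have "\<forall>\<^sub>F t::real in nhds 0. t \<in> {-1<..}"
      by (rule eventually_nhds_in_open) auto
    then show "\<forall>\<^sub>F t::real in nhds 0. (1 + t) * star_gauge M x = star_gauge M (x + t *\<^sub>R x)"
    proof eventually_elim
      case (elim t)
      then show ?case using star_gauge_scaleR[of "1 + t" x] by (simp add: scaleR_left_distrib)
    qed
  qed auto
  ultimately show ?thesis by (rule DERIV_unique)
qed

lemma star_gauge_derivative_tangential:
  assumes \<alpha>: "0 < \<alpha>" "\<alpha> \<le> pi / 2" "tangent_condition \<alpha> M"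
    and x: "x \<noteq> 0" "(star_gauge M has_derivative N') (at x)" and h: "h \<bullet> x = 0"
  shows "\<bar>N' h\<bar> * norm x \<le> cot \<alpha> * star_gauge M x * norm h"
proof -
  interpret bounded_linear N' using x(2) by (rule has_derivative_bounded_linear)
  let ?N = "star_gauge M"
  have "((\<lambda>t. ?N (x + t *\<^sub>R h)) has_derivative (\<lambda>t. N' (t *\<^sub>R h))) (at (0::real))"
    by (rule has_derivative_compose[where g = "?N"])
      (use x in \<open>auto intro!: derivative_eq_intros\<close>)
  then have "((\<lambda>t. ?N (x + t *\<^sub>R h)) has_real_derivative N' h) (at 0)"
    by (simp add: has_field_derivative_def scaleR mult_commute_abs)
  then have lim: "((\<lambda>t. (?N (x + t *\<^sub>R h) - ?N x) / t) \<longlongrightarrow> N' h) (at 0)"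
    by (simp add: DERIV_def)
  have tang: "tangential x h = h" using h by (simp add: tangential_def)
  have "\<bar>N' h\<bar> * norm x \<le> \<kappa> * ?N x * norm h" if \<kappa>: "cot \<alpha> < \<kappa>" for \<kappa>
  proof -
    have "((\<lambda>t. x + t *\<^sub>R h) \<longlongrightarrow> x) (at 0)"
      by (auto intro!: tendsto_eq_intros)
    from eventually_compose_filterlim[OF star_gauge_tangential[OF \<alpha> \<kappa> x(1)] this]
    have "\<forall>\<^sub>F t in at 0. \<bar>(?N (x + t *\<^sub>R h) - ?N x) * (norm x)\<^sup>2\<bar> \<le> \<kappa> * ?N x * norm x * (\<bar>t\<bar> * norm h)"
      by eventually_elim (simp add: h tangential_scaleR tang)
    moreover have "\<forall>\<^sub>F t::real in at 0. t \<noteq> 0" by (simp add: eventually_at_filter)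
    ultimately have "\<forall>\<^sub>F t in at 0. \<bar>(?N (x + t *\<^sub>R h) - ?N x) / t\<bar> * norm x \<le> \<kappa> * ?N x * norm h"
    proof eventually_elim
      case (elim t)
      from elim(1) have "(\<bar>?N (x + t *\<^sub>R h) - ?N x\<bar> * norm x) * norm x \<le> (\<kappa> * ?N x * norm h * \<bar>t\<bar>) * norm x"
        by (simp add: abs_mult power2_eq_square mult_ac)
      then have "\<bar>?N (x + t *\<^sub>R h) - ?N x\<bar> * norm x \<le> \<kappa> * ?N x * norm h * \<bar>t\<bar>"
        using x(1) by simp
      then show ?case using elim(2) by (simp add: field_simps)
    qed
    then show ?thesis
      by (intro tendsto_upperbound[of "\<lambda>t. \<bar>(?N (x + t *\<^sub>R h) - ?N x) / t\<bar> * norm x" _ "at 0"] tendsto_intros lim) auto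
  qed
  then have "\<forall>\<^sub>F \<kappa> in at_right (cot \<alpha>). \<bar>N' h\<bar> * norm x \<le> \<kappa> * ?N x * norm h"
    by (auto simp: eventually_at_filter)
  then show ?thesis
    by (intro tendsto_lowerbound[of "\<lambda>\<kappa>. \<kappa> * ?N x * norm h" _ "at_right (cot \<alpha>)"] tendsto_intros) auto
qed

end

section \<open>Pointwise distortion\<close>

text \<open>With a functional \<open>l\<close> such that \<open>l x = 1\<close>, the map \<open>h \<mapsto> h - 2 l(h) x\<close> is the reflection that
  fixes the kernel of \<open>l\<close> and reverses \<open>x\<close>; it is oblique unless the kernel is orthogonal to \<open>x\<close>.\<close>

lemma scaled_reflection_involutive:
  fixes l :: "'a::euclidean_space \<Rightarrow> real"
  assumes "bounded_linear l" "l x = 1"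
  shows "(h - (2 * l h) *\<^sub>R x) - (2 * l (h - (2 * l h) *\<^sub>R x)) *\<^sub>R x = h"
proof -
  interpret bounded_linear l by fact
  have "l (h - (2 * l h) *\<^sub>R x) = - l h" by (simp add: diff scaleR assms)
  then show ?thesis by (simp add: algebra_simps)
qed

text \<open>The norm of an oblique reflection. The bound \<open>s = \<kappa> + sqrt (1 + \<kappa>\<^sup>2)\<close> is the positive
  root of \<open>s\<^sup>2 = 1 + 2 \<kappa> s\<close>. With \<open>p\<close> and \<open>q\<close> the lengths of the radial and the tangential
  part of \<open>h\<close>, the image has squared length at most \<open>(p + 2 \<kappa> q)\<^sup>2 + q\<^sup>2\<close>, and
  \<open>s\<^sup>2 (p\<^sup>2 + q\<^sup>2)\<close> exceeds this by \<open>(2 \<kappa> / s) (s p - q)\<^sup>2\<close>.\<close>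

lemma scaled_reflection_norm_le:
  fixes l :: "'a::euclidean_space \<Rightarrow> real"
  assumes "bounded_linear l" "l x = 1" "x \<noteq> 0" "0 \<le> \<kappa>"
    and tang: "\<And>h. h \<bullet> x = 0 \<Longrightarrow> \<bar>l h\<bar> * norm x \<le> \<kappa> * norm h"
  shows "norm (h - (2 * l h) *\<^sub>R x) \<le> (\<kappa> + sqrt (1 + \<kappa>\<^sup>2)) * norm h"
proof -
  interpret bounded_linear l by fact
  define a where "a = (h \<bullet> x) / (x \<bullet> x)"
  define w where "w = tangential x h"
  define s where "s = \<kappa> + sqrt (1 + \<kappa>\<^sup>2)"
  have h: "h = a *\<^sub>R x + w" unfolding a_def w_def by (rule tangential_decomp)
  have wx: "w \<bullet> x = 0" unfolding w_def by (rule tangential_inner) fact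
  define p where "p = \<bar>a\<bar> * norm x"
  define q where "q = norm w"
  have "sqrt (1 + \<kappa>\<^sup>2) > 0" by (simp add: add_pos_nonneg)
  then have "s > 0" using \<open>0 \<le> \<kappa>\<close> unfolding s_def by linarith
  have s2: "s\<^sup>2 = 1 + 2 * \<kappa> * s"
    by (simp add: s_def power2_sum algebra_simps add_nonneg_nonneg) (simp add: power2_eq_square)
  have "h - (2 * l h) *\<^sub>R x = (- (a + 2 * l w)) *\<^sub>R x + w"
  proof -
    have lh: "2 * l h = a + (a + 2 * l w)" by (simp add: h add scaleR assms)
    have hw: "h - a *\<^sub>R x = w" by (simp add: h)
    show ?thesis
      unfolding lh scaleR_left_distrib[of a "a + 2 * l w"] diff_diff_eq[symmetric] hw
      by (simp only: scaleR_minus_left uminus_add_conv_diff)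
  qed
  then have eq: "(norm (h - (2 * l h) *\<^sub>R x))\<^sup>2 = (norm ((- (a + 2 * l w)) *\<^sub>R x))\<^sup>2 + q\<^sup>2"
    unfolding q_def by (simp only:) (rule norm_add_Pythagorean, simp add: orthogonal_def wx inner_commute[of x w])
  have "norm ((- (a + 2 * l w)) *\<^sub>R x) \<le> p + 2 * \<kappa> * q"
  proof -
    have "norm ((- (a + 2 * l w)) *\<^sub>R x) = \<bar>a + 2 * l w\<bar> * norm x"
      by (simp only: norm_scaleR abs_minus_cancel)
    also have "\<dots> \<le> (\<bar>a\<bar> + 2 * \<bar>l w\<bar>) * norm x" by (intro mult_right_mono) auto
    also have "\<dots> \<le> p + 2 * \<kappa> * q" using tang[OF wx] by (simp add: p_def q_def algebra_simps)
    finally show ?thesis .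
  qed
  then have "(norm ((- (a + 2 * l w)) *\<^sub>R x))\<^sup>2 \<le> (p + 2 * \<kappa> * q)\<^sup>2"
    by (rule power_mono) simp
  then have "(norm (h - (2 * l h) *\<^sub>R x))\<^sup>2 \<le> (p + 2 * \<kappa> * q)\<^sup>2 + q\<^sup>2"
    by (simp only: eq add_right_mono)
  also have "(p + 2 * \<kappa> * q)\<^sup>2 + q\<^sup>2 \<le> s\<^sup>2 * (p\<^sup>2 + q\<^sup>2)"
  proof -
    have "s * (s\<^sup>2 * (p\<^sup>2 + q\<^sup>2) - ((p + 2 * \<kappa> * q)\<^sup>2 + q\<^sup>2)) = 2 * \<kappa> * (s * p - q)\<^sup>2"
      using s2 by algebra
    also have "\<dots> \<ge> 0" using \<open>0 \<le> \<kappa>\<close> by simp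
    finally show ?thesis using \<open>s > 0\<close> by (simp add: zero_le_mult_iff)
  qed
  also have "p\<^sup>2 + q\<^sup>2 = (norm h)\<^sup>2"
    unfolding h by (subst norm_add_Pythagorean)
      (simp_all add: p_def q_def orthogonal_def wx inner_commute[of x w] power_mult_distrib)
  finally have "(norm (h - (2 * l h) *\<^sub>R x))\<^sup>2 \<le> (s * norm h)\<^sup>2"
    by (simp add: power_mult_distrib)
  then show ?thesis
    unfolding s_def[symmetric] by (rule power2_le_imp_le) (use \<open>s > 0\<close> in simp)
qed

lemma stretch_bounds:
  assumes f: "(f has_derivative (\<lambda>h. c *\<^sub>R A h)) (at x)" and "0 < c" "0 < s"
    and upp: "\<And>h. norm (A h) \<le> s * norm h" and low: "\<And>h. norm h \<le> s * norm (A h)"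
  shows "max_stretch f x \<le> c * s" "c / s \<le> min_stretch f x"
proof -
  have fr: "frechet_derivative f (at x) = (\<lambda>h. c *\<^sub>R A h)"
    using frechet_derivative_at[OF f] by simp
  have ne: "sphere 0 1 \<noteq> ({} :: 'a set)" by simp
  show "max_stretch f x \<le> c * s"
    unfolding max_stretch_def fr
  proof (rule cSUP_least[OF ne])
    fix h :: 'a assume "h \<in> sphere 0 1"
    then show "norm (c *\<^sub>R A h) \<le> c * s"
      using upp[of h] \<open>0 < c\<close> by simp
  qed
  show "c / s \<le> min_stretch f x"
    unfolding min_stretch_def fr
  proof (rule cINF_greatest[OF ne])
    fix h :: 'a assume "h \<in> sphere 0 1"
    then show "c / s \<le> norm (c *\<^sub>R A h)"
      using low[of h] \<open>0 < c\<close> \<open>0 < s\<close> by (simp add: field_simps)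
  qed
qed

lemma abs_det_involution:
  fixes A :: "real^'n \<Rightarrow> real^'n"
  assumes "linear A" "\<And>h. A (A h) = h"
  shows "\<bar>det (matrix A)\<bar> = 1"
proof -
  have "matrix A ** matrix A = matrix (A \<circ> A)"
    using matrix_compose[OF assms(1) assms(1)] by simp
  also have "A \<circ> A = id" using assms(2) by auto
  finally have "det (matrix A) * det (matrix A) = 1"
    by (metis det_I det_mul matrix_id_mat_1)
  then show ?thesis by (simp add: abs_square_eq_1 power2_eq_square flip: power2_eq_square)
qed

lemma abs_det_jacobian_scaled_involution:
  fixes f :: "real^'n \<Rightarrow> real^'n"
  assumes f: "(f has_derivative (\<lambda>h. c *\<^sub>R A h)) (at x)" and "0 < c"
    and A: "linear A" "\<And>h. A (A h) = h"
  shows "\<bar>det (jacobian f (at x))\<bar> = c ^ CARD('n)"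
proof -
  have "jacobian f (at x) = matrix (\<lambda>h. c *\<^sub>R A h)"
    by (simp add: jacobian_def frechet_derivative_at[OF f, symmetric])
  also have "\<dots> = (\<chi> i. c *s row i (matrix A))"
    by (simp add: matrix_def row_def vec_eq_iff)
  also have "det \<dots> = c ^ CARD('n) * det (\<chi> i. row i (matrix A))"
    by (subst det_rows_mul) simp
  also have "(\<chi> i. row i (matrix A)) = matrix A" by (simp add: row_def vec_eq_iff)
  finally show ?thesis using abs_det_involution[OF A] \<open>0 < c\<close> by (simp add: abs_mult)
qed

section \<open>Absolute continuity on lines\<close>

lemma lipschitz_imp_abs_continuous_on_interval:
  assumes "0 \<le> B" and lip: "\<And>s t. a \<le> s \<Longrightarrow> s < t \<Longrightarrow> t \<le> b \<Longrightarrow> norm (g t - g s) \<le> B * (t - s)"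
  shows "abs_continuous_on_interval g a b"
  unfolding abs_continuous_on_interval_def
proof (intro allI impI)
  fix \<epsilon> :: real assume "\<epsilon> > 0"
  show "\<exists>\<delta>>0. \<forall>P. finite P \<and> (\<forall>(s, t)\<in>P. a \<le> s \<and> s < t \<and> t \<le> b) \<and>
        pairwise (\<lambda>(s, t) (s', t'). {s<..<t} \<inter> {s'<..<t'} = {}) P \<and>
        (\<Sum>(s, t)\<in>P. t - s) < \<delta> \<longrightarrow> (\<Sum>(s, t)\<in>P. norm (g t - g s)) < \<epsilon>"
  proof (intro exI[of _ "\<epsilon> / (B + 1)"] conjI allI impI)
    show "0 < \<epsilon> / (B + 1)" using \<open>\<epsilon> > 0\<close> \<open>0 \<le> B\<close> by simp
    fix P :: "(real \<times> real) set"
    assume P: "finite P \<and> (\<forall>(s, t)\<in>P. a \<le> s \<and> s < t \<and> t \<le> b) \<and>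
        pairwise (\<lambda>(s, t) (s', t'). {s<..<t} \<inter> {s'<..<t'} = {}) P \<and>
        (\<Sum>(s, t)\<in>P. t - s) < \<epsilon> / (B + 1)"
    have "(\<Sum>(s, t)\<in>P. norm (g t - g s)) \<le> (\<Sum>(s, t)\<in>P. B * (t - s))"
      by (rule sum_mono) (use P lip in auto)
    also have "\<dots> = B * (\<Sum>(s, t)\<in>P. t - s)"
      by (simp add: sum_distrib_left case_prod_unfold)
    also have "\<dots> \<le> B * (\<epsilon> / (B + 1))"
      using P \<open>0 \<le> B\<close> by (intro mult_left_mono) auto
    also have "\<dots> < \<epsilon>"
      using \<open>\<epsilon> > 0\<close> \<open>0 \<le> B\<close> by (simp add: field_simps)
    finally show "(\<Sum>(s, t)\<in>P. norm (g t - g s)) < \<epsilon>" .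
  qed
qed

lemma ACL_onI_lipschitz:
  fixes f :: "real^'n \<Rightarrow> real^'n"
  assumes "continuous_on U f"
    and lip: "\<And>a b. cbox a b \<subseteq> U \<Longrightarrow> \<exists>B. B-lipschitz_on (cbox a b) f"
  shows "ACL_on U f"
  unfolding ACL_on_def
proof (intro conjI allI impI AE_I2)
  fix a b :: "real^'n" and i and y :: "'n \<Rightarrow> real"
  assume "cbox a b \<subseteq> U" and y: "\<forall>j\<in>UNIV - {i}. a $ j \<le> y j \<and> y j \<le> b $ j"
  then obtain B where B: "B-lipschitz_on (cbox a b) f" using lip by blast
  let ?p = "\<lambda>s. \<chi> j. if j = i then s else y j"
  show "abs_continuous_on_interval (\<lambda>s. f (?p s)) (a $ i) (b $ i)"
  proof (rule lipschitz_imp_abs_continuous_on_interval)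
    show "0 \<le> B" using B by (rule lipschitz_on_nonneg)
    fix s t assume st: "a $ i \<le> s" "s < t" "t \<le> b $ i"
    have in_box: "?p r \<in> cbox a b" if "a $ i \<le> r" "r \<le> b $ i" for r
      using y that by (auto simp: mem_box_cart)
    have "?p t - ?p s = (t - s) *\<^sub>R axis i 1"
      by (auto simp: vec_eq_iff axis_def)
    then have "dist (?p t) (?p s) = t - s"
      using st by (simp add: dist_norm norm_axis_1)
    then show "norm (f (?p t) - f (?p s)) \<le> B * (t - s)"
      using lipschitz_onD[OF B in_box in_box, of t s] st by (simp add: dist_norm)
  qed
qed fact

section \<open>The quasi-inversion of the extended space\<close>

text \<open>Neighbourhoods of infinity are the open sets with bounded complement.\<close>

lemma openin_Alexandroff_euclidean:
  fixes V :: "'a::euclidean_space option set"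
  shows "openin (Alexandroff_compactification euclidean) V \<longleftrightarrow>
    open {x. Some x \<in> V} \<and> (None \<in> V \<longrightarrow> bounded (- {x. Some x \<in> V}))"
proof -
  let ?W = "{x. Some x \<in> V}"
  have 1: "(\<exists>U. open U \<and> V = Some ` U) \<longleftrightarrow> None \<notin> V \<and> open ?W"
  proof
    assume "None \<notin> V \<and> open ?W"
    moreover from this have "V = Some ` ?W" by (auto, metis imageI mem_Collect_eq not_None_eq)
    ultimately show "\<exists>U. open U \<and> V = Some ` U" by blast
  qed (auto simp: image_iff)
  have 2: "(\<exists>C. compact C \<and> closed C \<and> V = insert None (Some ` (- C)))
      \<longleftrightarrow> None \<in> V \<and> open ?W \<and> bounded (- ?W)"
  proof
    assume R: "None \<in> V \<and> open ?W \<and> bounded (- ?W)"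
    moreover have "V = insert None (Some ` (- (- ?W)))"
      using R by (auto, metis imageI mem_Collect_eq not_None_eq)
    ultimately show "\<exists>C. compact C \<and> closed C \<and> V = insert None (Some ` (- C))"
      by (intro exI[of _ "- ?W"]) (auto simp: compact_eq_bounded_closed closed_Compl)
  next
    assume "\<exists>C. compact C \<and> closed C \<and> V = insert None (Some ` (- C))"
    then obtain C where C: "compact C" "closed C" "V = insert None (Some ` (- C))" by blast
    then have "?W = - C" by auto
    then show "None \<in> V \<and> open ?W \<and> bounded (- ?W)"
      using C by (simp add: open_Compl compact_imp_bounded)
  qed
  show ?thesis
    using 1 2 by (auto simp: openin_Alexandroff_compactification Compl_eq_Diff_UNIV)
qed

context
  fixes M :: "'a::euclidean_space set"
  assumes M: "star_surface M"
begin

lemma quasi_inversion_None [simp]: "quasi_inversion M None = Some 0"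
  by (simp add: quasi_inversion_def)

lemma quasi_inversion_zero [simp]: "quasi_inversion M (Some 0) = None"
  by (simp add: quasi_inversion_def)

lemma quasi_inversion_nonzero:
  assumes "x \<noteq> 0"
  shows "quasi_inversion M (Some x) = Some (x /\<^sub>R (star_gauge M x)\<^sup>2)"
  using assms star_gauge_pos[OF M assms]
  by (simp add: quasi_inversion_def radial_point_eq[OF M] power_mult_distrib power_inverse divide_simps)

lemma quasi_inversion_involution: "quasi_inversion M (quasi_inversion M p) = p"
proof (cases p)
  case (Some x)
  show ?thesis
  proof (cases "x = 0")
    case False
    let ?N = "star_gauge M x"
    have N: "?N > 0" by (rule star_gauge_pos[OF M False])
    have "star_gauge M (x /\<^sub>R ?N\<^sup>2) = inverse (?N\<^sup>2) * ?N"
      using N by (intro star_gauge_scaleR[OF M]) simp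
    also have "\<dots> = inverse ?N" using N by (simp add: power2_eq_square)
    finally show ?thesis
      using N False Some by (simp add: quasi_inversion_nonzero power_inverse)
  qed (simp add: Some)
qed simp

lemma quasi_inversion_norm_bounds:
  obtains c C where "0 < c" "0 < C"
    "\<And>x. x \<noteq> 0 \<Longrightarrow> c / norm x \<le> norm (x /\<^sub>R (star_gauge M x)\<^sup>2)"
    "\<And>x. x \<noteq> 0 \<Longrightarrow> norm (x /\<^sub>R (star_gauge M x)\<^sup>2) \<le> C / norm x"
proof -
  obtain m R where m: "0 < m" "0 < R"
    "\<And>x. norm x / R \<le> star_gauge M x" "\<And>x. star_gauge M x \<le> norm x / m"
    using star_gauge_bounds[OF M] by metis
  have "m\<^sup>2 / norm x \<le> norm (x /\<^sub>R (star_gauge M x)\<^sup>2) \<and> norm (x /\<^sub>R (star_gauge M x)\<^sup>2) \<le> R\<^sup>2 / norm x"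
    if "x \<noteq> 0" for x
  proof -
    let ?N = "star_gauge M x"
    have N: "?N > 0" by (rule star_gauge_pos[OF M that])
    have "?N\<^sup>2 \<le> (norm x / m)\<^sup>2" using N m(4) by (intro power_mono) auto
    then have 1: "?N\<^sup>2 * m\<^sup>2 \<le> (norm x)\<^sup>2" using m by (simp add: power_divide field_simps)
    have "(norm x / R)\<^sup>2 \<le> ?N\<^sup>2" using m by (intro power_mono) auto
    then have 2: "(norm x)\<^sup>2 \<le> ?N\<^sup>2 * R\<^sup>2" using m by (simp add: power_divide field_simps)
    show ?thesis
      using 1 2 N that by (simp add: field_simps power2_eq_square)
  qed
  then show thesis using that[of "m\<^sup>2" "R\<^sup>2"] m by auto
qed

lemma quasi_inversion_homeomorphic:
  "homeomorphic_map (Alexandroff_compactification euclidean) (Alexandroff_compactification euclidean)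
     (quasi_inversion M)"
proof (rule homeomorphic_map_involution)
  let ?F = "quasi_inversion M" and ?f = "\<lambda>x. x /\<^sub>R (star_gauge M x)\<^sup>2"
  obtain c C where c: "0 < c" "0 < C" "\<And>x. x \<noteq> 0 \<Longrightarrow> c / norm x \<le> norm (?f x)"
    "\<And>x. x \<noteq> 0 \<Longrightarrow> norm (?f x) \<le> C / norm x"
    using quasi_inversion_norm_bounds by metis
  have "openin (Alexandroff_compactification euclidean) {p. ?F p \<in> V}"
    if "openin (Alexandroff_compactification euclidean) V" for V
  proof -
    define W where "W = {x. Some x \<in> V}"
    have W: "open W" "None \<in> V \<Longrightarrow> bounded (- W)"
      using that by (auto simp: openin_Alexandroff_euclidean W_def)
    define W' where "W' = {x. ?F (Some x) \<in> V}"
    have W': "x \<in> W' \<longleftrightarrow> ?f x \<in> W" if "x \<noteq> 0" for x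
      using that by (simp add: W'_def W_def quasi_inversion_nonzero)
    have "open W'"
      unfolding open_subopen[of W'] eventually_nhds[symmetric]
    proof
      fix x assume x: "x \<in> W'"
      have "\<forall>\<^sub>F y in nhds x. y \<in> W'"
      proof (cases "x = 0")
        case False
        have "isCont ?f x"
          using star_gauge_pos[OF M False]
          by (intro continuous_intros isCont_star_gauge[OF M False]) auto
        then have "(?f \<longlongrightarrow> ?f x) (nhds x)"
          using tendsto_at_iff_tendsto_nhds[of ?f x] by (simp add: isCont_def)
        then have "\<forall>\<^sub>F y in nhds x. ?f y \<in> W"
          by (rule topological_tendstoD) (use W x W' False in auto)
        moreover have "\<forall>\<^sub>F y in nhds x. y \<noteq> 0" using False by (intro t1_space_nhds)
        ultimately show ?thesis by eventually_elim (simp add: W')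
      next
        case True
        then have "None \<in> V" using x by (simp add: W'_def)
        then obtain B where B: "B > 0" "\<And>y. y \<notin> W \<Longrightarrow> norm y \<le> B"
          using W(2) by (auto simp: bounded_pos)
        have "y \<in> W'" if "norm y < c / B" for y
        proof (cases "y = 0")
          case False
          then have "B < c / norm y" using that B by (simp add: field_simps)
          also have "\<dots> \<le> norm (?f y)" using c False by blast
          finally show ?thesis using W'[OF False] B(2) by (meson not_less)
        qed (use x True in simp)
        then show ?thesis
          unfolding eventually_nhds_metric using True B c by (auto intro!: exI[of _ "c / B"])
      qed
      then show "\<exists>T. open T \<and> x \<in> T \<and> T \<subseteq> W'" unfolding eventually_nhds by blast
    qed
    moreover have "bounded (- W')" if "?F None \<in> V"
    proof -
      have "0 \<in> W" using that by (simp add: W_def)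
      then obtain e where e: "e > 0" "ball 0 e \<subseteq> W" using W openE by blast
      have "norm y \<le> C / e" if "y \<notin> W'" for y
      proof (rule ccontr)
        assume "\<not> norm y \<le> C / e"
        then have y: "C / e < norm y" by simp
        moreover have "C / e > 0" using c e by simp
        ultimately have "y \<noteq> 0" by auto
        have "norm (?f y) \<le> C / norm y" using c \<open>y \<noteq> 0\<close> by blast
        also have "\<dots> < e" using y e \<open>y \<noteq> 0\<close> by (simp add: field_simps)
        finally have "?f y \<in> ball 0 e" by (simp only: mem_ball_0)
        then show False using e W'[OF \<open>y \<noteq> 0\<close>] that by blast
      qed
      then show ?thesis by (auto simp: bounded_iff)
    qed
    ultimately show ?thesis by (simp add: openin_Alexandroff_euclidean W'_def)
  qed
  then show "continuous_map (Alexandroff_compactification euclidean) (Alexandroff_compactification euclidean) ?F"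
    by (simp add: continuous_map_def flip: UNIV_option_conv)
qed (rule quasi_inversion_involution)

lemma quasi_inversion_has_derivative:
  assumes "x \<noteq> 0" and N': "(star_gauge M has_derivative N') (at x)"
  shows "((\<lambda>y. the (quasi_inversion M (Some y))) has_derivative
    (\<lambda>h. (1 / (star_gauge M x)\<^sup>2) *\<^sub>R (h - (2 * (N' h / star_gauge M x)) *\<^sub>R x))) (at x)"
proof (rule has_derivative_transform_within_open[of "\<lambda>y. (1 / (star_gauge M y)\<^sup>2) *\<^sub>R y" _ _ _ "- {0}"])
  have N: "star_gauge M x > 0" by (rule star_gauge_pos[OF M assms(1)])
  show "((\<lambda>y. (1 / (star_gauge M y)\<^sup>2) *\<^sub>R y) has_derivative
    (\<lambda>h. (1 / (star_gauge M x)\<^sup>2) *\<^sub>R (h - (2 * (N' h / star_gauge M x)) *\<^sub>R x))) (at x)"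
  proof -
    have "((\<lambda>t. 1 / t\<^sup>2) has_real_derivative - 2 / star_gauge M x ^ 3) (at (star_gauge M x))"
      using N by (auto intro!: derivative_eq_intros simp: field_simps power2_eq_square power3_eq_cube)
    from has_derivative_scaleR[OF DERIV_compose_FDERIV[OF this N'] has_derivative_ident]
    show ?thesis
      by (rule has_derivative_eq_rhs)
        (use N in \<open>simp add: fun_eq_iff scaleR_diff_right power2_eq_square power3_eq_cube\<close>)
  qed
  show "(1 / (star_gauge M y)\<^sup>2) *\<^sub>R y = the (quasi_inversion M (Some y))" if "y \<in> - {0}" for y
    using that by (simp add: quasi_inversion_nonzero inverse_eq_divide)
qed (use assms in auto)

lemma quasi_inversion_lipschitz_on_compact:
  assumes lip: "L-lipschitz_on UNIV (star_gauge M)" and S: "compact S" "0 \<notin> S"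
  shows "\<exists>B. B-lipschitz_on S (\<lambda>x. the (quasi_inversion M (Some x)))"
proof -
  obtain R where R: "0 < R" "\<And>x. norm x / R \<le> star_gauge M x"
    using star_gauge_bounds[OF M] by metis
  obtain d where d: "d > 0" "ball 0 d \<subseteq> - S"
    using S openE[of "- S" 0] compact_imp_closed by (metis ComplI open_Compl)
  obtain E where E: "E > 0" "\<And>w. w \<in> S \<Longrightarrow> norm w \<le> E"
    using compact_imp_bounded[OF S(1)] bounded_pos by metis
  have L: "L \<ge> 0" using lip by (rule lipschitz_on_nonneg)
  define A where "A = R / d"
  have "A > 0" using d R by (simp add: A_def)
  define a where "a x = 1 / star_gauge M x" for x
  have a: "0 < a x \<and> a x \<le> A" if "x \<in> S" for x
  proof -
    have "x \<noteq> 0" using that S by auto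
    have "d \<le> norm x" using d that by force
    then have "d / R \<le> norm x / R" using R by (simp add: divide_right_mono)
    also have "\<dots> \<le> star_gauge M x" by (rule R)
    finally show ?thesis
      using star_gauge_pos[OF M \<open>x \<noteq> 0\<close>] d R by (simp add: a_def A_def field_simps)
  qed
  have "(A\<^sup>2 + L * A\<^sup>2 * (2 * A) * E)-lipschitz_on S (\<lambda>x. the (quasi_inversion M (Some x)))"
  proof (rule lipschitz_onI)
    show "0 \<le> A\<^sup>2 + L * A\<^sup>2 * (2 * A) * E" using L \<open>A > 0\<close> E by auto
    fix x y assume xy: "x \<in> S" "y \<in> S"
    then have "x \<noteq> 0" "y \<noteq> 0" using S by auto
    have "\<bar>a x - a y\<bar> = \<bar>star_gauge M y - star_gauge M x\<bar> * (a x * a y)"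
      using star_gauge_pos[OF M \<open>x \<noteq> 0\<close>] star_gauge_pos[OF M \<open>y \<noteq> 0\<close>]
      by (simp add: a_def divide_simps abs_mult abs_divide flip: abs_mult)
    also have "\<dots> \<le> (L * norm (x - y)) * (A * A)"
      using a[OF xy(1)] a[OF xy(2)] lipschitz_onD[OF lip, of y x] L
      by (intro mult_mono) (auto simp: dist_norm norm_minus_commute)
    finally have ab: "\<bar>a x - a y\<bar> \<le> L * A\<^sup>2 * norm (x - y)" by (simp add: power2_eq_square mult_ac)
    have "\<bar>(a x)\<^sup>2 - (a y)\<^sup>2\<bar> = \<bar>a x - a y\<bar> * (a x + a y)"
      using a[OF xy(1)] a[OF xy(2)] by (simp add: square_diff_square_factored power2_eq_square abs_mult)
    also have "\<dots> \<le> (L * A\<^sup>2 * norm (x - y)) * (2 * A)"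
      using a[OF xy(1)] a[OF xy(2)] ab L by (intro mult_mono) auto
    finally have ab2: "\<bar>(a x)\<^sup>2 - (a y)\<^sup>2\<bar> \<le> (L * A\<^sup>2 * norm (x - y)) * (2 * A)" .
    have "dist (the (quasi_inversion M (Some x))) (the (quasi_inversion M (Some y)))
        = norm ((a x)\<^sup>2 *\<^sub>R (x - y) + ((a x)\<^sup>2 - (a y)\<^sup>2) *\<^sub>R y)"
      using \<open>x \<noteq> 0\<close> \<open>y \<noteq> 0\<close>
      by (simp add: quasi_inversion_nonzero dist_norm a_def power_divide inverse_eq_divide algebra_simps)
    also have "\<dots> \<le> (a x)\<^sup>2 * norm (x - y) + \<bar>(a x)\<^sup>2 - (a y)\<^sup>2\<bar> * norm y"
      by (rule order_trans[OF norm_triangle_ineq]) simp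
    also have "\<dots> \<le> A\<^sup>2 * norm (x - y) + ((L * A\<^sup>2 * norm (x - y)) * (2 * A)) * E"
      using a[OF xy(1)] ab2 E(2)[OF xy(2)] L \<open>A > 0\<close>
      by (intro add_mono mult_mono power_mono) auto
    finally show "dist (the (quasi_inversion M (Some x))) (the (quasi_inversion M (Some y)))
        \<le> (A\<^sup>2 + L * A\<^sup>2 * (2 * A) * E) * dist x y"
      by (simp add: dist_norm algebra_simps)
  qed
  then show ?thesis ..
qed

end

section \<open>Quasiconformality of the quasi-inversion\<close>

text \<open>At almost every point the gauge is differentiable with logarithmic slope at most \<open>\<kappa> / \<bar>x\<bar>\<close> in the
  directions orthogonal to \<open>x\<close>. Equivalently, \<open>log r\<^sub>x\<close> has slope at most \<open>\<kappa>\<close> almost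
  everywhere on the unit sphere.\<close>

definition tangential_slope_le :: "real \<Rightarrow> 'a::euclidean_space set \<Rightarrow> bool" where
  "tangential_slope_le \<kappa> M \<longleftrightarrow> (AE x in lebesgue. x \<noteq> 0 \<longrightarrow>
     (\<exists>N'. (star_gauge M has_derivative N') (at x) \<and>
       (\<forall>h. h \<bullet> x = 0 \<longrightarrow> \<bar>N' h\<bar> * norm x \<le> \<kappa> * star_gauge M x * norm h)))"

lemma tangent_condition_imp_slope_le:
  assumes M: "star_surface M" and \<alpha>: "0 < \<alpha>" "\<alpha> \<le> pi / 2" "tangent_condition \<alpha> M"
  shows "tangential_slope_le (cot \<alpha>) M"
proof -
  obtain L where "L-lipschitz_on UNIV (star_gauge M)"
    using star_gauge_lipschitz[OF M \<alpha>] by blast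
  then have "AE x in lebesgue. star_gauge M differentiable at x"
    by (rule Rademacher)
  then show ?thesis
    unfolding tangential_slope_le_def
    by eventually_elim
      (use star_gauge_derivative_tangential[OF M \<alpha>] in \<open>auto simp: differentiable_def\<close>)
qed

text \<open>The bound for the linear dilatation of the quasi-inversion that follows from the slope bound
  \<open>\<kappa>\<close>: the square of the norm of the oblique reflection above.\<close>

definition slope_dilatation :: "real \<Rightarrow> real" where
  "slope_dilatation \<kappa> = (\<kappa> + sqrt (1 + \<kappa>\<^sup>2))\<^sup>2"

lemma slope_dilatation_cot:
  assumes "0 < \<alpha>" "\<alpha> \<le> pi / 2"
  shows "slope_dilatation (cot \<alpha>) = (cot (\<alpha> / 2))\<^sup>2"
proof -
  have sin: "sin \<alpha> > 0" using assms pi_gt_zero by (intro sin_gt_zero) auto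
  have sin2: "sin (\<alpha> / 2) > 0" using assms pi_gt_zero by (intro sin_gt_zero) auto
  have "1 + (cot \<alpha>)\<^sup>2 = (1 / sin \<alpha>)\<^sup>2"
    using sin by (simp add: cot_def power_divide field_simps)
  then have "cot \<alpha> + sqrt (1 + (cot \<alpha>)\<^sup>2) = (cos \<alpha> + 1) / sin \<alpha>"
    using sin by (simp add: cot_def add_divide_distrib)
  also have "cos \<alpha> + 1 = 2 * (cos (\<alpha> / 2))\<^sup>2"
    using cos_double_cos[of "\<alpha> / 2"] by simp
  also have "sin \<alpha> = 2 * sin (\<alpha> / 2) * cos (\<alpha> / 2)"
    using sin_double[of "\<alpha> / 2"] by simp
  also have "2 * (cos (\<alpha> / 2))\<^sup>2 / (2 * sin (\<alpha> / 2) * cos (\<alpha> / 2)) = cot (\<alpha> / 2)"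
    by (simp add: cot_def power2_eq_square)
  finally show ?thesis by (simp add: slope_dilatation_def)
qed

text \<open>The derivative of the quasi-inversion is \<open>star_gauge M x ^ -2\<close> times an oblique reflection
  \<open>A\<close>. As \<open>A\<close> is an involution, one bound for its norm gives both stretch estimates, and its
  determinant is \<open>\<plusminus>1\<close>.\<close>

lemma quasi_inversion_distortion:
  fixes M :: "(real^'n) set"
  assumes M: "star_surface M" and "x \<noteq> 0" "0 \<le> \<kappa>"
    and N': "(star_gauge M has_derivative N') (at x)"
    and tang: "\<And>h. h \<bullet> x = 0 \<Longrightarrow> \<bar>N' h\<bar> * norm x \<le> \<kappa> * star_gauge M x * norm h"
  defines "s \<equiv> \<kappa> + sqrt (1 + \<kappa>\<^sup>2)" and "c \<equiv> 1 / (star_gauge M x)\<^sup>2"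
    and "f \<equiv> \<lambda>y. the (quasi_inversion M (Some y))"
  shows "f differentiable at x" "max_stretch f x \<le> c * s" "c / s \<le> min_stretch f x"
    "\<bar>det (jacobian f (at x))\<bar> = c ^ CARD('n)" "0 < c" "1 \<le> s"
proof -
  have N: "star_gauge M x > 0" by (rule star_gauge_pos[OF M \<open>x \<noteq> 0\<close>])
  show "0 < c" using N by (simp add: c_def)
  have "1 \<le> sqrt (1 + \<kappa>\<^sup>2)" by simp
  then show "1 \<le> s" using \<open>0 \<le> \<kappa>\<close> unfolding s_def by linarith
  then have "0 < s" by simp
  define l where "l h = N' h / star_gauge M x" for h
  define A where "A h = h - (2 * l h) *\<^sub>R x" for h
  have l: "bounded_linear l"
    unfolding l_def[abs_def]
    by (rule bounded_linear_compose[OF bounded_linear_divide has_derivative_bounded_linear[OF N']])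
  have lx: "l x = 1"
    using star_gauge_derivative_radial[OF M \<open>x \<noteq> 0\<close> N'] N by (simp add: l_def)
  have l_tang: "\<bar>l h\<bar> * norm x \<le> \<kappa> * norm h" if "h \<bullet> x = 0" for h
    using tang[OF that] N by (simp add: l_def field_simps)
  have AA: "A (A h) = h" for h
    unfolding A_def by (rule scaled_reflection_involutive[OF l lx])
  have A_le: "norm (A h) \<le> s * norm h" for h
    unfolding A_def s_def
    by (rule scaled_reflection_norm_le[OF l lx \<open>x \<noteq> 0\<close> \<open>0 \<le> \<kappa>\<close> l_tang])
  have le_A: "norm h \<le> s * norm (A h)" for h
    using A_le[of "A h"] by (simp add: AA)
  have f: "(f has_derivative (\<lambda>h. c *\<^sub>R A h)) (at x)"
    using quasi_inversion_has_derivative[OF M \<open>x \<noteq> 0\<close> N'] by (simp add: f_def c_def A_def l_def)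
  have "bounded_linear A"
    unfolding A_def[abs_def]
    by (intro bounded_linear_sub bounded_linear_ident bounded_linear_scaleR_const
        bounded_linear_const_mult l)
  then have "linear A" by (rule bounded_linear.linear)
  show "f differentiable at x" using f by (auto simp: differentiable_def)
  show "max_stretch f x \<le> c * s" "c / s \<le> min_stretch f x"
    using stretch_bounds[OF f \<open>0 < c\<close> \<open>0 < s\<close> A_le le_A] by auto
  show "\<bar>det (jacobian f (at x))\<bar> = c ^ CARD('n)"
    by (rule abs_det_jacobian_scaled_involution[OF f \<open>0 < c\<close> \<open>linear A\<close> AA])
qed

lemma min_stretch_le_max_stretch:
  fixes f :: "real^'n \<Rightarrow> real^'n"
  assumes "f differentiable at x"
  shows "min_stretch f x \<le> max_stretch f x"
proof -
  let ?g = "\<lambda>h. norm (frechet_derivative f (at x) h)"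
  have "bounded_linear (frechet_derivative f (at x))"
    using assms by (metis frechet_derivative_works has_derivative_bounded_linear)
  then obtain B where B: "\<And>h. ?g h \<le> norm h * B"
    using bounded_linear.bounded by blast
  define e :: "real^'n" where "e = axis undefined 1"
  have e: "e \<in> sphere 0 1" by (simp add: e_def norm_axis_1)
  have "min_stretch f x \<le> ?g e"
    unfolding min_stretch_def by (intro cINF_lower[OF _ e] bdd_belowI2[of _ 0]) auto
  also have "\<dots> \<le> max_stretch f x"
    unfolding max_stretch_def
    by (intro cSUP_upper[OF e] bdd_aboveI2[of _ _ B]) (metis B mem_sphere_0 mult_1)
  finally show ?thesis .
qed

theorem quasi_inversion_K_quasiconformal:
  fixes M :: "(real^'n) set"
  assumes n: "CARD('n) \<ge> 2" and M: "star_surface M"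
    and lip: "L-lipschitz_on UNIV (star_gauge M)"
    and "0 \<le> \<kappa>" and slope: "tangential_slope_le \<kappa> M"
  shows "K_quasiconformal_ext (slope_dilatation \<kappa>) (quasi_inversion M)"
proof -
  let ?F = "quasi_inversion M"
  define f where "f x = the (?F (Some x))" for x
  define s where "s = \<kappa> + sqrt (1 + \<kappa>\<^sup>2)"
  have "1 \<le> sqrt (1 + \<kappa>\<^sup>2)" by simp
  then have "1 \<le> s" using \<open>0 \<le> \<kappa>\<close> unfolding s_def by linarith
  have U: "{x. ?F (Some x) \<noteq> None} = - {0}"
    using quasi_inversion_nonzero[OF M] by (force simp: quasi_inversion_def)
  have f: "f x \<noteq> 0" "f (f x) = x" if "x \<noteq> 0" for x
  proof -
    have *: "?F (Some x) = Some (f x)"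
      using that quasi_inversion_nonzero[OF M] by (simp add: f_def)
    have **: "?F (Some (f x)) = Some x"
      using quasi_inversion_involution[OF M, of "Some x"] by (simp add: *)
    then show "f x \<noteq> 0" by (auto simp: quasi_inversion_def)
    show "f (f x) = x" using ** by (simp add: f_def)
  qed
  have fU: "f ` (- {0}) = - {0}"
  proof
    show "f ` (- {0}) \<subseteq> - {0}" by (rule image_subsetI) (simp add: f)
    show "- {0} \<subseteq> f ` (- {0})" using f by (metis ComplD ComplI image_eqI insertI1 singletonD subsetI)
  qed
  have cont: "continuous_on (- {0}) f"
  proof (rule continuous_on_eq)
    show "continuous_on (- {0}) (\<lambda>x. x /\<^sub>R (star_gauge M x)\<^sup>2)"
      using star_gauge_pos[OF M] lip
      by (intro continuous_intros continuous_on_subset[OF lipschitz_on_continuous_on[OF lip]])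
        (auto dest!: star_gauge_pos[OF M])
  qed (simp add: f_def quasi_inversion_nonzero[OF M])
  have conn: "connected (- {0 :: real^'n})"
    using n by (intro connected_punctured_universe) simp
  have ne: "- {0 :: real^'n} \<noteq> {}"
  proof -
    have "axis undefined 1 \<in> - {0 :: real^'n}" by simp
    then show ?thesis by blast
  qed
  have ACL: "ACL_on (- {0}) f"
  proof (rule ACL_onI_lipschitz[OF cont])
    fix a b :: "real^'n" assume "cbox a b \<subseteq> - {0}"
    then show "\<exists>B. B-lipschitz_on (cbox a b) f"
      unfolding f_def[abs_def] by (intro quasi_inversion_lipschitz_on_compact[OF M lip]) auto
  qed
  have AE: "AE x in lebesgue. x \<in> - {0} \<longrightarrow> f differentiable at x \<and>
      max_stretch f x ^ CARD('n) / s ^ CARD('n) \<le> \<bar>det (jacobian f (at x))\<bar> \<and>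
      \<bar>det (jacobian f (at x))\<bar> \<le> s ^ CARD('n) * min_stretch f x ^ CARD('n) \<and>
      0 < min_stretch f x \<and> max_stretch f x / min_stretch f x \<le> slope_dilatation \<kappa>"
    using slope unfolding tangential_slope_le_def
  proof eventually_elim
    case (elim x)
    show ?case
    proof
      assume "x \<in> - {0}"
      then have "x \<noteq> 0" by simp
      with elim obtain N' where N': "(star_gauge M has_derivative N') (at x)"
        "\<And>h. h \<bullet> x = 0 \<Longrightarrow> \<bar>N' h\<bar> * norm x \<le> \<kappa> * star_gauge M x * norm h" by blast
      define c where "c = 1 / (star_gauge M x)\<^sup>2"
      note d = quasi_inversion_distortion[OF M \<open>x \<noteq> 0\<close> \<open>0 \<le> \<kappa>\<close> N',
          folded s_def c_def f_def[abs_def]]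
      have min_pos: "0 < min_stretch f x"
        using d(3,5) \<open>1 \<le> s\<close> by (smt (verit) divide_pos_pos)
      have max_nonneg: "0 \<le> max_stretch f x"
        using min_stretch_le_max_stretch[OF d(1)] min_pos by simp
      have "max_stretch f x ^ CARD('n) \<le> (c * s) ^ CARD('n)"
        using d(2) max_nonneg by (rule power_mono)
      then have 1: "max_stretch f x ^ CARD('n) / s ^ CARD('n) \<le> c ^ CARD('n)"
        using \<open>1 \<le> s\<close> by (simp add: power_mult_distrib divide_le_eq)
      have "(c / s) ^ CARD('n) \<le> min_stretch f x ^ CARD('n)"
        using d(3,5) \<open>1 \<le> s\<close> by (intro power_mono) auto
      then have 2: "c ^ CARD('n) \<le> s ^ CARD('n) * min_stretch f x ^ CARD('n)"
        using \<open>1 \<le> s\<close> by (simp add: power_divide divide_le_eq mult.commute)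
      have "max_stretch f x \<le> s\<^sup>2 * (c / s)"
        using d(2) \<open>1 \<le> s\<close> by (simp add: power2_eq_square mult.commute)
      also have "\<dots> \<le> s\<^sup>2 * min_stretch f x"
        using d(3) by (intro mult_left_mono) auto
      finally have 3: "max_stretch f x / min_stretch f x \<le> slope_dilatation \<kappa>"
        using min_pos by (simp add: slope_dilatation_def s_def divide_le_eq)
      show "f differentiable at x \<and>
        max_stretch f x ^ CARD('n) / s ^ CARD('n) \<le> \<bar>det (jacobian f (at x))\<bar> \<and>
        \<bar>det (jacobian f (at x))\<bar> \<le> s ^ CARD('n) * min_stretch f x ^ CARD('n) \<and>
        0 < min_stretch f x \<and> max_stretch f x / min_stretch f x \<le> slope_dilatation \<kappa>"
        using d(1,4) 1 2 3 min_pos by simp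
    qed
  qed
  have "homeomorphism (- {0}) (- {0}) f f"
    using cont f fU by (auto simp: homeomorphism_def)
  moreover have "AE x in lebesgue. x \<in> - {0} \<longrightarrow> f differentiable at x"
    using AE by eventually_elim simp
  moreover have "AE x in lebesgue. x \<in> - {0} \<longrightarrow>
        max_stretch f x ^ CARD('n) / s ^ CARD('n) \<le> \<bar>det (jacobian f (at x))\<bar> \<and>
        \<bar>det (jacobian f (at x))\<bar> \<le> s ^ CARD('n) * min_stretch f x ^ CARD('n)"
    using AE by eventually_elim simp
  moreover have "0 < s ^ CARD('n)" using \<open>1 \<le> s\<close> by simp
  ultimately have "quasiconformal (- {0}) (- {0}) f"
    unfolding quasiconformal_def using conn ne ACL by (auto simp: open_Compl)
  moreover have "AE x in lebesgue. x \<in> - {0} \<longrightarrow>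
      0 < min_stretch f x \<and> max_stretch f x / min_stretch f x \<le> slope_dilatation \<kappa>"
    using AE by eventually_elim simp
  ultimately have "K_quasiconformal (slope_dilatation \<kappa>) (- {0}) (- {0}) f"
    by (simp add: K_quasiconformal_def)
  then show ?thesis
    unfolding K_quasiconformal_ext_def Let_def U f_def[abs_def, symmetric] fU
    using quasi_inversion_homeomorphic[OF M] by blast
qed

section \<open>The quasiconformality constant\<close>

lemma K_quasiconformal_ext_ge_1:
  assumes "K_quasiconformal_ext K F"
  shows "1 \<le> K"
proof -
  define U where "U = {x. F (Some x) \<noteq> None}"
  define f where "f x = the (F (Some x))" for x
  have K: "K_quasiconformal K U (f ` U) f"
    using assms unfolding K_quasiconformal_ext_def Let_def U_def f_def[abs_def] by simp
  then have "open U" "U \<noteq> {}" and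
    AE: "AE x in lebesgue. x \<in> U \<longrightarrow> f differentiable at x"
    "AE x in lebesgue. x \<in> U \<longrightarrow> 0 < min_stretch f x \<and> max_stretch f x / min_stretch f x \<le> K"
    by (auto simp: K_quasiconformal_def quasiconformal_def)
  have "\<exists>x\<in>U. f differentiable at x \<and> 0 < min_stretch f x \<and> max_stretch f x / min_stretch f x \<le> K"
  proof (rule ccontr)
    assume none: "\<not> ?thesis"
    from AE have "AE x in lebesgue. x \<notin> U"
      by eventually_elim (use none in blast)
    then have "negligible U"
      by (auto simp: eventually_ae_filter negligible_iff_null_sets[symmetric] intro: negligible_subset)
    then show False using \<open>open U\<close> \<open>U \<noteq> {}\<close> open_not_negligible by blast
  qed
  then obtain x where "x \<in> U" and x: "f differentiable at x" "0 < min_stretch f x"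
    "max_stretch f x / min_stretch f x \<le> K" by blast
  then have "max_stretch f x \<le> K * min_stretch f x" by (simp add: divide_le_eq)
  then have "1 * min_stretch f x \<le> K * min_stretch f x"
    using min_stretch_le_max_stretch[OF x(1)] by simp
  then show ?thesis using x(2) by (rule mult_right_le_imp_le)
qed

text \<open>The set of admissible constants contains its infimum, since countably many conditions holding
  almost everywhere hold simultaneously almost everywhere. So the least one exists.\<close>

lemma qc_constant_bounds:
  assumes "K_quasiconformal_ext K F"
  shows "1 \<le> qc_constant F" "qc_constant F \<le> K"
proof -
  define S where "S = {K. K_quasiconformal_ext K F}"
  define k where "k = Inf S"
  have "K \<in> S" using assms by (simp add: S_def)
  have bdd: "bdd_below S"
    using K_quasiconformal_ext_ge_1[of _ F] by (auto simp: S_def intro!: bdd_belowI[of _ 1])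
  define U where "U = {x. F (Some x) \<noteq> None}"
  define f where "f x = the (F (Some x))" for x
  have S_iff: "J \<in> S \<longleftrightarrow> homeomorphic_map (Alexandroff_compactification euclidean)
       (Alexandroff_compactification euclidean) F \<and> quasiconformal U (f ` U) f \<and>
      (AE x in lebesgue. x \<in> U \<longrightarrow> 0 < min_stretch f x \<and> max_stretch f x / min_stretch f x \<le> J)" for J
    unfolding S_def K_quasiconformal_ext_def Let_def U_def f_def[abs_def] K_quasiconformal_def by simp
  have "\<exists>J\<in>S. J < k + inverse (real (Suc i))" for i
    using cInf_lessD[of S "k + inverse (real (Suc i))"] \<open>K \<in> S\<close> by (auto simp: k_def)
  then obtain J where J: "\<And>i. J i \<in> S" "\<And>i. J i < k + inverse (real (Suc i))" by metis
  have "AE x in lebesgue. \<forall>i. x \<in> U \<longrightarrow> 0 < min_stretch f x \<and> max_stretch f x / min_stretch f x \<le> J i"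
    unfolding AE_all_countable using J(1) S_iff by blast
  then have "AE x in lebesgue. x \<in> U \<longrightarrow> 0 < min_stretch f x \<and> max_stretch f x / min_stretch f x \<le> k"
  proof eventually_elim
    case (elim x)
    show ?case
    proof
      assume "x \<in> U"
      have "max_stretch f x / min_stretch f x \<le> k"
      proof (rule field_le_epsilon)
        fix e :: real assume "e > 0"
        then obtain i where "inverse (real (Suc i)) < e" using reals_Archimedean by blast
        then show "max_stretch f x / min_stretch f x \<le> k + e"
          using elim \<open>x \<in> U\<close> J(2)[of i] by (meson add_le_cancel_left less_imp_le order_trans)
      qed
      then show "0 < min_stretch f x \<and> max_stretch f x / min_stretch f x \<le> k"
        using elim \<open>x \<in> U\<close> by blast
    qed
  qed
  then have "k \<in> S" using \<open>K \<in> S\<close> unfolding S_iff by blast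
  have "qc_constant F = k"
    unfolding qc_constant_def
    by (rule Least_equality) (use \<open>k \<in> S\<close> bdd in \<open>auto simp: S_def k_def intro: cInf_lower\<close>)
  then show "1 \<le> qc_constant F" "qc_constant F \<le> K"
    using \<open>k \<in> S\<close> K_quasiconformal_ext_ge_1 \<open>K \<in> S\<close> bdd by (auto simp: S_def k_def intro: cInf_lower)
qed

section \<open>Surfaces close to a sphere\<close>

text \<open>The surface measure is defined by the cones inside the unit ball; the null set of directions
  excluded there is spread over the whole space by integer dilations.\<close>

lemma AE_unit_sphere_measure_imp_AE:
  fixes P :: "'a::euclidean_space \<Rightarrow> bool"
  assumes "AE u in unit_sphere_measure. P u"
  shows "AE x in lebesgue. x \<noteq> 0 \<longrightarrow> P (x /\<^sub>R norm x)"
proof -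
  let ?\<Omega> = "ball 0 1 - {0} :: 'a set"
  let ?D = "distr (restrict_space lborel ?\<Omega>) (restrict_space borel (sphere 0 1)) (\<lambda>x. x /\<^sub>R norm x)"
  obtain N where N: "N \<in> sets ?D" "emeasure (unit_sphere_measure :: 'a measure) N = 0"
    "{u \<in> space ?D. \<not> P u} \<subseteq> N"
    using assms by (auto simp: eventually_ae_filter unit_sphere_measure_def null_sets_def space_scale_measure)
  have "emeasure ?D N = 0"
    using N(2) by (auto simp: unit_sphere_measure_def of_nat_eq_0_iff)
  then have "AE u in ?D. P u"
    using N by (intro AE_I) auto
  moreover have "(\<lambda>x. x /\<^sub>R norm x) \<in> measurable (restrict_space lborel ?\<Omega>) (restrict_space borel (sphere 0 1))"
    by (rule measurable_restrict_space2) (auto simp: space_restrict_space intro!: measurable_restrict_space1)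
  ultimately have "AE x in restrict_space lborel ?\<Omega>. P (x /\<^sub>R norm x)"
    by (rule AE_distrD[rotated])
  then have "AE x in lborel. x \<in> ?\<Omega> \<longrightarrow> P (x /\<^sub>R norm x)"
    by (subst (asm) AE_restrict_space_iff) auto
  then have "AE x in lebesgue. x \<in> ?\<Omega> \<longrightarrow> P (x /\<^sub>R norm x)"
    by (rule AE_completion)
  then obtain B where B: "negligible B" "\<And>x. x \<in> ?\<Omega> \<Longrightarrow> \<not> P (x /\<^sub>R norm x) \<Longrightarrow> x \<in> B"
    by (auto simp: eventually_ae_filter negligible_iff_null_sets)
  have "negligible (\<Union>k. (\<lambda>x. real (Suc k) *\<^sub>R x) ` B)"
  proof (rule negligible_countable_Union, goal_cases)
    case 2
    have "(\<lambda>x. real (Suc k) *\<^sub>R x) differentiable_on B" for k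
      by (auto simp: differentiable_on_def intro!: derivative_intros)
    then have "negligible ((\<lambda>x. real (Suc k) *\<^sub>R x) ` B)" for k
      by (intro negligible_differentiable_image_negligible B(1) order_refl)
    then show ?case using 2 by blast
  qed simp
  then have "AE x in lebesgue. x \<notin> (\<Union>k. (\<lambda>x. real (Suc k) *\<^sub>R x) ` B)"
    unfolding negligible_iff_null_sets by (rule AE_not_in)
  then show ?thesis
  proof eventually_elim
    case (elim x)
    show ?case
    proof (intro impI, rule ccontr)
      assume x: "x \<noteq> 0" "\<not> P (x /\<^sub>R norm x)"
      obtain k where k: "norm x < real (Suc k)"
        using reals_Archimedean2[of "norm x"] by (metis less_Suc_eq of_nat_less_iff order_less_trans)
      define y where "y = x /\<^sub>R real (Suc k)"
      have "y \<in> ?\<Omega>" using x k by (simp add: y_def field_simps del: of_nat_Suc)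
      moreover have "y /\<^sub>R norm y = x /\<^sub>R norm x"
        using x by (simp add: y_def field_simps del: of_nat_Suc)
      ultimately have "y \<in> B" using B(2) x by simp
      moreover have "x = real (Suc k) *\<^sub>R y" by (simp add: y_def del: of_nat_Suc)
      ultimately show False using elim by blast
    qed
  qed
qed

lemma radial_extension_eq:
  assumes "star_surface M"
  shows "radial_extension M x = (norm x / star_gauge M x) *\<^sub>R x"
proof (cases "x = 0")
  case False
  have "star_gauge M (x /\<^sub>R norm x) = star_gauge M x / norm x"
    using star_gauge_scaleR[OF assms, of "inverse (norm x)" x] False by (simp add: divide_inverse mult.commute)
  then show ?thesis
    using False by (simp add: radial_extension_def radial_point_eq[OF assms] divide_inverse)
qed (simp add: radial_extension_def)

lemma star_gauge_has_derivative_scaleR: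
  assumes M: "star_surface M" and "0 < c" and N': "(star_gauge M has_derivative N') (at x)"
  shows "(star_gauge M has_derivative N') (at (c *\<^sub>R x))"
proof -
  interpret bounded_linear N' using N' by (rule has_derivative_bounded_linear)
  have "((\<lambda>y. c * star_gauge M (y /\<^sub>R c)) has_derivative (\<lambda>h. c * N' (h /\<^sub>R c))) (at (c *\<^sub>R x))"
  proof (rule has_derivative_mult_right, rule has_derivative_compose[where g = "star_gauge M"])
    show "((\<lambda>y. y /\<^sub>R c) has_derivative (\<lambda>h. h /\<^sub>R c)) (at (c *\<^sub>R x))"
      by (intro derivative_intros)
    show "(star_gauge M has_derivative N') (at ((c *\<^sub>R x) /\<^sub>R c))"
      using N' \<open>0 < c\<close> by simp
  qed
  moreover have "c * star_gauge M (y /\<^sub>R c) = star_gauge M y" for y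
    using star_gauge_scaleR[OF M \<open>0 < c\<close>, of "y /\<^sub>R c"] \<open>0 < c\<close> by simp
  moreover have "c * N' (h /\<^sub>R c) = N' h" for h
    using \<open>0 < c\<close> by (simp add: scaleR)
  ultimately show ?thesis by simp
qed

text \<open>For \<open>h\<close> orthogonal to \<open>u\<close> the derivative of the radial extension minus \<open>r\<close> times the identity
  sends \<open>h\<close> to \<open>(1 / N - r) *\<^sub>R h - (N' h / N\<^sup>2) *\<^sub>R u\<close> with \<open>N = star_gauge M u\<close>. The two terms are
  orthogonal, so each is bounded by \<open>\<epsilon> \<bar>h\<bar>\<close>: the first gives \<open>1 / N \<ge> r - \<epsilon>\<close>, the second then
  the slope.\<close>

lemma radial_extension_slope:
  fixes M :: "'a::euclidean_space set"
  assumes M: "star_surface M" and u: "norm u = 1"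
    and N': "(star_gauge M has_derivative N') (at u)"
    and on: "onorm (\<lambda>h. frechet_derivative (radial_extension M) (at u) h - r *\<^sub>R h) \<le> \<epsilon>"
    and "\<epsilon> < r" and h: "h \<bullet> u = 0"
  shows "\<bar>N' h\<bar> \<le> \<epsilon> / (r - \<epsilon>) * star_gauge M u * norm h"
proof (cases "h = 0")
  case True
  then show ?thesis using N' by (simp add: linear_0[OF bounded_linear.linear[OF has_derivative_bounded_linear[OF N']]])
next
  case False
  define N where "N = star_gauge M u"
  have "u \<noteq> 0" using u by auto
  have N: "N > 0" unfolding N_def by (rule star_gauge_pos[OF M \<open>u \<noteq> 0\<close>])
  define \<phi>' where "\<phi>' k = (1 / N) *\<^sub>R k + ((k \<bullet> u) / N - N' k / N\<^sup>2) *\<^sub>R u" for k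
  have "((\<lambda>x. (norm x / star_gauge M x) *\<^sub>R x) has_derivative \<phi>') (at u)"
  proof -
    have "((\<lambda>x. norm x / star_gauge M x) has_derivative
        (\<lambda>k. (k \<bullet> u) / N - N' k / N\<^sup>2)) (at u)"
      using has_derivative_divide'[OF has_derivative_norm[OF \<open>u \<noteq> 0\<close>, simplified] N'] N u
      by (simp add: N_def[symmetric] sgn_div_norm power2_eq_square diff_divide_distrib inner_commute)
    from has_derivative_scaleR[OF this has_derivative_ident] show ?thesis
      by (rule has_derivative_eq_rhs) (simp add: \<phi>'_def fun_eq_iff u N_def)
  qed
  then have \<phi>: "(radial_extension M has_derivative \<phi>') (at u)"
    by (simp add: radial_extension_eq[OF M, abs_def])
  then have fr: "frechet_derivative (radial_extension M) (at u) = \<phi>'"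
    by (simp add: frechet_derivative_at[symmetric])
  have "bounded_linear (\<lambda>h. \<phi>' h - r *\<^sub>R h)"
    by (intro bounded_linear_sub has_derivative_bounded_linear[OF \<phi>] bounded_linear_scaleR_right)
  from onorm[OF this, of h] on have "norm (\<phi>' h - r *\<^sub>R h) \<le> \<epsilon> * norm h"
    unfolding fr by (meson mult_right_mono norm_ge_zero order_trans)
  moreover have "\<phi>' h - r *\<^sub>R h = (1 / N - r) *\<^sub>R h + (- (N' h / N\<^sup>2)) *\<^sub>R u"
    by (simp add: \<phi>'_def h scaleR_diff_left)
  ultimately have le: "norm ((1 / N - r) *\<^sub>R h + (- (N' h / N\<^sup>2)) *\<^sub>R u) \<le> \<epsilon> * norm h" by simp
  have "(norm ((1 / N - r) *\<^sub>R h + (- (N' h / N\<^sup>2)) *\<^sub>R u))\<^sup>2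
      = (norm ((1 / N - r) *\<^sub>R h))\<^sup>2 + (norm ((- (N' h / N\<^sup>2)) *\<^sub>R u))\<^sup>2"
    by (rule norm_add_Pythagorean) (simp add: orthogonal_def h)
  also have "norm ((1 / N - r) *\<^sub>R h) = \<bar>1 / N - r\<bar> * norm h" by simp
  also have "norm ((- (N' h / N\<^sup>2)) *\<^sub>R u) = \<bar>N' h\<bar> / N\<^sup>2" using N u by simp
  finally have pyth: "(norm ((1 / N - r) *\<^sub>R h + (- (N' h / N\<^sup>2)) *\<^sub>R u))\<^sup>2
      = (\<bar>1 / N - r\<bar> * norm h)\<^sup>2 + (\<bar>N' h\<bar> / N\<^sup>2)\<^sup>2" .
  have "\<bar>1 / N - r\<bar> * norm h \<le> norm ((1 / N - r) *\<^sub>R h + (- (N' h / N\<^sup>2)) *\<^sub>R u)"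
    by (rule power2_le_imp_le) (simp_all only: pyth le_add_same_cancel1 zero_le_power2 norm_ge_zero)
  also note le
  finally have "\<bar>1 / N - r\<bar> \<le> \<epsilon>" by (rule mult_right_le_imp_le) (use False in simp)
  then have rN: "N * (r - \<epsilon>) \<le> 1" using N by (simp add: abs_le_iff field_simps)
  have "\<epsilon> \<ge> 0" using \<open>\<bar>1 / N - r\<bar> \<le> \<epsilon>\<close> by simp
  have "\<bar>N' h\<bar> / N\<^sup>2 \<le> norm ((1 / N - r) *\<^sub>R h + (- (N' h / N\<^sup>2)) *\<^sub>R u)"
    by (rule power2_le_imp_le) (simp_all only: pyth le_add_same_cancel2 zero_le_power2 norm_ge_zero)
  also note le
  finally have "\<bar>N' h\<bar> \<le> \<epsilon> * norm h * N * N"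
    using N by (simp add: divide_le_eq power2_eq_square mult_ac)
  then have "\<bar>N' h\<bar> * (r - \<epsilon>) \<le> (\<epsilon> * norm h * N * N) * (r - \<epsilon>)"
    using \<open>\<epsilon> < r\<close> by (intro mult_right_mono) auto
  also have "\<dots> = \<epsilon> * norm h * N * (N * (r - \<epsilon>))" by simp
  also have "\<dots> \<le> \<epsilon> * norm h * N * 1"
    using rN N \<open>\<epsilon> \<ge> 0\<close> by (intro mult_left_mono) auto
  finally show ?thesis
    using \<open>\<epsilon> < r\<close> by (simp add: N_def[symmetric] field_simps)
qed

lemma slope_le_if_close_to_sphere:
  fixes M :: "'a::euclidean_space set"
  assumes M: "star_surface M" and lip: "L-lipschitz_on UNIV (star_gauge M)" and "\<epsilon> < r"
    and ess: "esssup unit_sphere_measure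
      (\<lambda>x. ereal (onorm (\<lambda>h. frechet_derivative (radial_extension M) (at x) h - r *\<^sub>R h))) < ereal \<epsilon>"
  shows "tangential_slope_le (\<epsilon> / (r - \<epsilon>)) M"
proof -
  let ?on = "\<lambda>x. onorm (\<lambda>h. frechet_derivative (radial_extension M) (at x) h - r *\<^sub>R h)"
  have "AE u in unit_sphere_measure. ereal (?on u) \<le> esssup unit_sphere_measure (\<lambda>x. ereal (?on x))"
    by (rule esssup_AE)
  then have "AE u in unit_sphere_measure. ?on u \<le> \<epsilon>"
  proof eventually_elim
    case (elim u)
    from le_less_trans[OF elim ess] show ?case by simp
  qed
  from AE_unit_sphere_measure_imp_AE[OF this] Rademacher[OF lip] show ?thesis
    unfolding tangential_slope_le_def
  proof eventually_elim
    case (elim x)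
    show ?case
    proof
      assume "x \<noteq> 0"
      obtain N' where N': "(star_gauge M has_derivative N') (at x)"
        using elim by (auto simp: differentiable_def)
      have N'u: "(star_gauge M has_derivative N') (at (x /\<^sub>R norm x))"
        using star_gauge_has_derivative_scaleR[OF M _ N', of "inverse (norm x)"] \<open>x \<noteq> 0\<close> by simp
      have gu: "star_gauge M (x /\<^sub>R norm x) = star_gauge M x / norm x"
        using star_gauge_scaleR[OF M, of "inverse (norm x)" x] \<open>x \<noteq> 0\<close> by (simp add: divide_inverse mult.commute)
      have "\<bar>N' h\<bar> * norm x \<le> \<epsilon> / (r - \<epsilon>) * star_gauge M x * norm h" if "h \<bullet> x = 0" for h
      proof -
        have "\<bar>N' h\<bar> \<le> \<epsilon> / (r - \<epsilon>) * star_gauge M (x /\<^sub>R norm x) * norm h"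
          by (rule radial_extension_slope[OF M _ N'u _ \<open>\<epsilon> < r\<close>]) (use elim \<open>x \<noteq> 0\<close> that in auto)
        then have "\<bar>N' h\<bar> * norm x \<le> (\<epsilon> / (r - \<epsilon>) * (star_gauge M x / norm x) * norm h) * norm x"
          unfolding gu by (rule mult_right_mono) simp
        then show ?thesis using \<open>x \<noteq> 0\<close> by simp
      qed
      then show "\<exists>N'. (star_gauge M has_derivative N') (at x) \<and>
          (\<forall>h. h \<bullet> x = 0 \<longrightarrow> \<bar>N' h\<bar> * norm x \<le> \<epsilon> / (r - \<epsilon>) * star_gauge M x * norm h)"
        using N' by blast
    qed
  qed
qed

lemma slope_dilatation_small:
  assumes "0 < r" "0 < e"
  obtains \<epsilon> where "0 < \<epsilon>" "\<epsilon> < r" "slope_dilatation (\<epsilon> / (r - \<epsilon>)) < 1 + e"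
proof -
  have "((\<lambda>\<epsilon>. slope_dilatation (\<epsilon> / (r - \<epsilon>))) \<longlongrightarrow> slope_dilatation (0 / (r - 0))) (at_right 0)"
    unfolding slope_dilatation_def using assms by (intro tendsto_intros) auto
  then have "\<forall>\<^sub>F \<epsilon> in at_right 0. slope_dilatation (\<epsilon> / (r - \<epsilon>)) < 1 + e"
    by (rule order_tendstoD) (use assms in \<open>simp add: slope_dilatation_def\<close>)
  moreover have "\<forall>\<^sub>F \<epsilon> in at_right 0. \<epsilon> < r"
    using assms by (simp add: eventually_at_right_less eventually_at_right[of 0 r] exI[of _ r])
  moreover have "\<forall>\<^sub>F \<epsilon> in at_right 0. (0::real) < \<epsilon>"
    by (simp add: eventually_at_filter)
  ultimately have "\<forall>\<^sub>F \<epsilon> in at_right 0. 0 < \<epsilon> \<and> \<epsilon> < r \<and> slope_dilatation (\<epsilon> / (r - \<epsilon>)) < 1 + e"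
    by eventually_elim simp
  from eventually_happens[OF this] show thesis
    using that by auto
qed

theorem qc_constant_tendsto_1:
  fixes M :: "real \<Rightarrow> (real^'n) set"
  assumes n: "CARD('n) \<ge> 2"
    and M: "\<And>t. t \<in> {0..1} \<Longrightarrow> star_surface (M t)"
    and lip: "\<And>t. t \<in> {0..1} \<Longrightarrow> \<exists>L. L-lipschitz_on UNIV (star_gauge (M t))"
    and "0 < r" and conv: "smoothly_converges_to_sphere M r"
  shows "((\<lambda>t. qc_constant (quasi_inversion (M t))) \<longlongrightarrow> 1) (at 0 within {0..1})"
  unfolding tendsto_iff
proof (intro allI impI)
  fix e :: real assume "0 < e"
  then obtain \<epsilon> where \<epsilon>: "0 < \<epsilon>" "\<epsilon> < r" "slope_dilatation (\<epsilon> / (r - \<epsilon>)) < 1 + e"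
    using slope_dilatation_small[OF \<open>0 < r\<close>] by blast
  have "\<forall>\<^sub>F t in at 0 within {0..1}. esssup unit_sphere_measure
      (\<lambda>x. ereal (onorm (\<lambda>h. frechet_derivative (radial_extension (M t)) (at x) h - r *\<^sub>R h))) < ereal \<epsilon>"
    by (rule order_tendstoD(2)[OF conv[unfolded smoothly_converges_to_sphere_def]]) (use \<epsilon> in simp)
  moreover have "\<forall>\<^sub>F t in at 0 within {0..1}. t \<in> {0..1::real}"
    by (simp add: eventually_at_filter)
  ultimately show "\<forall>\<^sub>F t in at 0 within {0..1}. dist (qc_constant (quasi_inversion (M t))) 1 < e"
  proof eventually_elim
    case (elim t)
    obtain L where L: "L-lipschitz_on UNIV (star_gauge (M t))" using lip elim by blast
    have "tangential_slope_le (\<epsilon> / (r - \<epsilon>)) (M t)"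
      by (rule slope_le_if_close_to_sphere[OF M[OF elim(2)] L \<epsilon>(2) elim(1)])
    then have "K_quasiconformal_ext (slope_dilatation (\<epsilon> / (r - \<epsilon>))) (quasi_inversion (M t))"
      using \<epsilon> by (intro quasi_inversion_K_quasiconformal[OF n M[OF elim(2)] L]) auto
    from qc_constant_bounds[OF this] \<epsilon>(3) show ?case
      by (simp add: dist_real_def)
  qed
qed

lemma cot_half_dilatation:
  assumes "0 < \<alpha>" "\<alpha> \<le> pi / 2"
  shows "((cot (\<alpha> / 2))\<^sup>2 - 1) / ((cot (\<alpha> / 2))\<^sup>2 + 1) = cos \<alpha>" "1 \<le> (cot (\<alpha> / 2))\<^sup>2"
proof -
  have sin: "sin (\<alpha> / 2) > 0" using assms pi_gt_zero by (intro sin_gt_zero) auto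
  have "((cot (\<alpha> / 2))\<^sup>2 - 1) / ((cot (\<alpha> / 2))\<^sup>2 + 1)
      = ((cos (\<alpha> / 2))\<^sup>2 - (sin (\<alpha> / 2))\<^sup>2) / ((cos (\<alpha> / 2))\<^sup>2 + (sin (\<alpha> / 2))\<^sup>2)"
    using sin by (simp add: cot_def power_divide field_simps)
  also have "\<dots> = cos \<alpha>"
    using cos_double[of "\<alpha> / 2"] by simp
  finally show "((cot (\<alpha> / 2))\<^sup>2 - 1) / ((cot (\<alpha> / 2))\<^sup>2 + 1) = cos \<alpha>" .
  have "cos \<alpha> \<ge> 0" using assms by (intro cos_ge_zero) auto
  then have "(sin (\<alpha> / 2))\<^sup>2 \<le> (cos (\<alpha> / 2))\<^sup>2"
    using cos_double[of "\<alpha> / 2"] by simp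
  then show "1 \<le> (cot (\<alpha> / 2))\<^sup>2"
    using sin by (simp add: cot_def power_divide)
qed

theorem theorem5p11:
  assumes n: "CARD('n::finite) \<ge> 2"
  shows
    "(\<forall>(D :: (real^'n) set) \<alpha>.
        strictly_starlike 0 D \<and> 0 < \<alpha> \<and> \<alpha> \<le> pi / 2 \<and> tangent_condition \<alpha> (frontier D) \<longrightarrow>
        (let K = (cot (\<alpha> / 2))\<^sup>2 in
          K_quasiconformal_ext K (quasi_inversion (frontier D)) \<and>
          (CARD('n) = 2 \<longrightarrow>
             (K - 1) / (K + 1) = cos \<alpha> \<and>
             k_quasiconformal_ext (cos \<alpha>) (quasi_inversion (frontier D)))))
     \<and>
     (\<forall>(D :: real \<Rightarrow> (real^'n) set) (\<alpha> :: real \<Rightarrow> real) r.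
        (\<forall>t\<in>{0..1}. strictly_starlike 0 (D t) \<and> 0 < \<alpha> t \<and> \<alpha> t \<le> pi / 2 \<and>
                     tangent_condition (\<alpha> t) (frontier (D t))) \<and>
        0 < r \<and> smoothly_converges_to_sphere (\<lambda>t. frontier (D t)) r \<longrightarrow>
        ((\<lambda>t. qc_constant (quasi_inversion (frontier (D t)))) \<longlongrightarrow> 1) (at 0 within {0..1}))"
proof (intro conjI allI impI)
  fix D :: "(real^'n) set" and \<alpha> :: real
  assume A: "strictly_starlike 0 D \<and> 0 < \<alpha> \<and> \<alpha> \<le> pi / 2 \<and> tangent_condition \<alpha> (frontier D)"
  then have \<alpha>: "0 < \<alpha>" "\<alpha> \<le> pi / 2" "tangent_condition \<alpha> (frontier D)" by auto
  have M: "star_surface (frontier D)" using A strictly_starlike_imp_star_surface by blast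
  obtain L where L: "L-lipschitz_on UNIV (star_gauge (frontier D))"
    using star_gauge_lipschitz[OF M \<alpha>] by blast
  have "0 \<le> cot \<alpha>"
    using \<alpha> by (auto simp: cot_def intro!: divide_nonneg_nonneg cos_ge_zero sin_ge_zero)
  then have "K_quasiconformal_ext (slope_dilatation (cot \<alpha>)) (quasi_inversion (frontier D))"
    by (rule quasi_inversion_K_quasiconformal[OF n M L _ tangent_condition_imp_slope_le[OF M \<alpha>]])
  then have K: "K_quasiconformal_ext ((cot (\<alpha> / 2))\<^sup>2) (quasi_inversion (frontier D))"
    by (simp only: slope_dilatation_cot[OF \<alpha>(1,2)])
  then have "k_quasiconformal_ext (cos \<alpha>) (quasi_inversion (frontier D))"
    unfolding k_quasiconformal_ext_def using cot_half_dilatation[OF \<alpha>(1,2)] by metis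
  with K cot_half_dilatation(1)[OF \<alpha>(1,2)]
  show "let K = (cot (\<alpha> / 2))\<^sup>2 in
          K_quasiconformal_ext K (quasi_inversion (frontier D)) \<and>
          (CARD('n) = 2 \<longrightarrow>
             (K - 1) / (K + 1) = cos \<alpha> \<and>
             k_quasiconformal_ext (cos \<alpha>) (quasi_inversion (frontier D)))"
    unfolding Let_def by blast
next
  fix D :: "real \<Rightarrow> (real^'n) set" and \<alpha> :: "real \<Rightarrow> real" and r
  assume A: "(\<forall>t\<in>{0..1}. strictly_starlike 0 (D t) \<and> 0 < \<alpha> t \<and> \<alpha> t \<le> pi / 2 \<and>
                     tangent_condition (\<alpha> t) (frontier (D t))) \<and>
        0 < r \<and> smoothly_converges_to_sphere (\<lambda>t. frontier (D t)) r"
  then have M: "star_surface (frontier (D t))" if "t \<in> {0..1}" for t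
    using that strictly_starlike_imp_star_surface by blast
  have "\<exists>L. L-lipschitz_on UNIV (star_gauge (frontier (D t)))" if "t \<in> {0..1}" for t
    using star_gauge_lipschitz[OF M[OF that], of "\<alpha> t"] A that by blast
  then show "((\<lambda>t. qc_constant (quasi_inversion (frontier (D t)))) \<longlongrightarrow> 1) (at 0 within {0..1})"
    using A M by (intro qc_constant_tendsto_1[OF n, where r = r]) auto
qed

end
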